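(* Let $K>0$ and let $\mathcal{F}\subset H^1(\mathbb{T}^2)$ be a family of mean-free functions such that (A) $\|f\|_{L^1(\mathbb{T}^2)}\le K$ for all $f\in\mathcal{F}$, and (B) $\displaystyle\lim_{r\to0^+}\ \sup_{f\in\mathcal{F}}\ \sup_{z\in\mathbb{T}^2}\int_{\{|z-y|<r\}}|f(y)|\,dy=0.$ Then there exists a function $\Upsilon\in C^1$ on $[0,\infty)$, convex, increasing and superquadratic, such that $$\Upsilon\big(\|f\|_{L^2(\mathbb{T}^2)}^2\big)\le\|\nabla f\|_{L^2(\mathbb{T}^2)}^2\qquad\text{for all }f\in\mathcal{F}.$$
   Context: $\mathbb{T}^2=[-\pi,\pi]^2$ is the flat torus. A function $f$ is mean-free if $\int_{\mathbb{T}^2}f\,dx=0$. Superquadratic means $\Upsilon(x)/x^2\to+\infty$ as $x\to+\infty$. *)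

theory Defs
  imports "HOL-Analysis.Analysis"
begin

text \<open>
  The flat torus is represented by the fundamental square. A function on the torus is a function
  on the plane of which only the values on the square matter (up to Lebesgue null sets; the
  identified edges are a null set). The identification of opposite edges enters through the
  periodicity of the test functions and through the distance \<open>torus_dist\<close>.
\<close>

definition torus :: "(real \<times> real) set" where
  "torus = {- pi..pi} \<times> {- pi..pi}"

abbreviation torus_measure :: "(real \<times> real) measure" where
  "torus_measure \<equiv> lebesgue_on torus"

definition torus_dist :: "real \<times> real \<Rightarrow> real \<times> real \<Rightarrow> real" where
  "torus_dist x y =
    (INF (k, l) \<in> (UNIV :: (int \<times> int) set).
      norm (x - y + (2 * pi * of_int k, 2 * pi * of_int l)))"

definition L1_norm :: "(real \<times> real \<Rightarrow> 'b::euclidean_space) \<Rightarrow> real" where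
  "L1_norm f = (\<integral>x. norm (f x) \<partial>torus_measure)"

definition in_L2 :: "(real \<times> real \<Rightarrow> 'b::euclidean_space) \<Rightarrow> bool" where
  "in_L2 f \<longleftrightarrow>
    f \<in> borel_measurable torus_measure \<and> integrable torus_measure (\<lambda>x. (norm (f x))\<^sup>2)"

definition L2_norm :: "(real \<times> real \<Rightarrow> 'b::euclidean_space) \<Rightarrow> real" where
  "L2_norm f = sqrt (\<integral>x. (norm (f x))\<^sup>2 \<partial>torus_measure)"

definition mean_free :: "(real \<times> real \<Rightarrow> real) \<Rightarrow> bool" where
  "mean_free f \<longleftrightarrow> (\<integral>x. f x \<partial>torus_measure) = 0"

definition partial_deriv ::
    "real \<times> real \<Rightarrow> (real \<times> real \<Rightarrow> real) \<Rightarrow> real \<times> real \<Rightarrow> real" where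
  "partial_deriv e \<phi> x = frechet_derivative \<phi> (at x) e"

primrec C_k :: "nat \<Rightarrow> (real \<times> real \<Rightarrow> real) \<Rightarrow> bool" where
  "C_k 0 \<phi> \<longleftrightarrow> continuous_on UNIV \<phi>"
| "C_k (Suc k) \<phi> \<longleftrightarrow>
    (\<forall>x. \<phi> differentiable (at x)) \<and> (\<forall>e\<in>Basis. C_k k (partial_deriv e \<phi>))"

definition torus_test_function :: "(real \<times> real \<Rightarrow> real) \<Rightarrow> bool" where
  "torus_test_function \<phi> \<longleftrightarrow>
    (\<forall>k. C_k k \<phi>) \<and> (\<forall>e\<in>Basis. \<forall>x. \<phi> (x + (2 * pi) *\<^sub>R e) = \<phi> x)"

definition has_weak_gradient ::
    "(real \<times> real \<Rightarrow> real) \<Rightarrow> (real \<times> real \<Rightarrow> real \<times> real) \<Rightarrow> bool" where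
  "has_weak_gradient f g \<longleftrightarrow>
    (\<forall>\<phi>. torus_test_function \<phi> \<longrightarrow> (\<forall>e\<in>Basis.
      (\<integral>x. f x * partial_deriv e \<phi> x \<partial>torus_measure) = - (\<integral>x. (g x \<bullet> e) * \<phi> x \<partial>torus_measure)))"

definition H1 :: "(real \<times> real \<Rightarrow> real) set" where
  "H1 = {f. in_L2 f \<and> (\<exists>g. in_L2 g \<and> has_weak_gradient f g)}"

text \<open>A weak gradient is unique almost everywhere, so norms do not depend on the choice.\<close>

definition weak_gradient :: "(real \<times> real \<Rightarrow> real) \<Rightarrow> real \<times> real \<Rightarrow> real \<times> real" where
  "weak_gradient f = (SOME g. in_L2 g \<and> has_weak_gradient f g)"

text \<open>At the endpoint 0 the derivative is one-sided.\<close>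

definition C1_on_nonneg :: "(real \<Rightarrow> real) \<Rightarrow> bool" where
  "C1_on_nonneg F \<longleftrightarrow>
    (\<exists>F'. (\<forall>x\<in>{0..}. (F has_real_derivative F' x) (at x within {0..})) \<and> continuous_on {0..} F')"

definition superquadratic :: "(real \<Rightarrow> real) \<Rightarrow> bool" where
  "superquadratic F \<longleftrightarrow> filterlim (\<lambda>x. F x / x\<^sup>2) at_top at_top"

end

theory Submission
  imports Defs
begin

text \<open>
  For a trigonometric polynomial \<open>\<phi>\<close> and a shift \<open>v = (a, b)\<close> in \<open>[0, s]\<^sup>2\<close>, write \<open>\<integral>f \<phi>\<close> as
  \<open>\<integral>f (\<phi> - \<phi>(\<cdot> + v))\<close> plus \<open>\<integral>f \<phi>(\<cdot> + v)\<close>. The difference \<open>\<phi>(\<cdot> + v) - \<phi>\<close> is a sum of derivatives of segment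
  integrals of \<open>\<phi>\<close>, whose \<open>L\<^sup>2\<close> norms are of order \<open>s \<parallel>\<phi>\<parallel>\<close>, so the first term is at most of order
  \<open>s \<parallel>\<nabla>f\<parallel> \<parallel>\<phi>\<parallel>\<close>. By Young's inequality the second term is controlled by \<open>K\<close> and by
  \<open>\<integral>\<bar>f\<bar> \<phi>(\<cdot> + v)\<^sup>2\<close>, and the mean of the latter over \<open>v\<close> is at most of order \<open>s^(-2) \<eta> \<parallel>\<phi>\<parallel>\<^sup>2\<close>, where \<open>\<eta>\<close>
  bounds the mass of \<open>\<bar>f\<bar>\<close> on small balls. Letting \<open>\<phi>\<close> tend to \<open>f\<close> in \<open>L\<^sup>2\<close> gives
  \<open>\<parallel>f\<parallel>\<^sup>2 \<le> 80 s\<^sup>2 \<parallel>\<nabla>f\<parallel>\<^sup>2 + 16 \<eta> K / s\<^sup>2\<close>, and \<open>s\<^sup>2 = 32 \<eta> K / \<parallel>f\<parallel>\<^sup>2\<close> turns this into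
  \<open>\<parallel>f\<parallel>\<^sup>4 \<le> 5120 \<eta> K \<parallel>\<nabla>f\<parallel>\<^sup>2\<close> for large \<open>\<parallel>f\<parallel>\<close>, with \<open>\<eta>\<close> as small as desired.
\<close>

section \<open>Trigonometric polynomials\<close>

text \<open>The free phase \<open>c\<close> covers sines as well as cosines and keeps translates and
  derivatives of a generator in the span of the generators. Integer frequencies give period
  \<open>2 * pi\<close> in both coordinates.\<close>

inductive_set trig :: "(real \<times> real \<Rightarrow> real) set" where
  cos: "(\<lambda>x. cos (of_int m * fst x + of_int n * snd x + c)) \<in> trig"
| add: "\<phi> \<in> trig \<Longrightarrow> \<psi> \<in> trig \<Longrightarrow> (\<lambda>x. \<phi> x + \<psi> x) \<in> trig"
| scale: "\<phi> \<in> trig \<Longrightarrow> (\<lambda>x. a * \<phi> x) \<in> trig"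

lemma trig_const: "(\<lambda>x. a) \<in> trig"
  using trig.scale[OF trig.cos[of 0 0 0], of a] by simp

text \<open>The product-to-sum formula settles two generators. Linearity in \<open>\<psi>\<close>
  gives this lemma, and linearity in the other factor then gives closure under all products.\<close>

lemma trig_cos_mult:
  assumes "\<psi> \<in> trig"
  shows "(\<lambda>x. cos (of_int m * fst x + of_int n * snd x + c) * \<psi> x) \<in> trig"
  using assms
proof induction
  case (cos m' n' c')
  have eq: "cos (of_int m * fst x + of_int n * snd x + c) *
      cos (of_int m' * fst x + of_int n' * snd x + c') =
      1/2 * cos (of_int (m - m') * fst x + of_int (n - n') * snd x + (c - c')) +
      1/2 * cos (of_int (m + m') * fst x + of_int (n + n') * snd x + (c + c'))" for x :: "real \<times> real"
    by (simp add: cos_times_cos algebra_simps add_divide_distrib)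
  show ?case
    unfolding eq by (intro trig.add trig.scale trig.cos)
next
  case (add \<phi> \<psi>)
  then show ?case by (simp add: distrib_left trig.add)
next
  case (scale \<phi> a)
  then show ?case using trig.scale[OF scale.IH, of a] by (simp add: mult.left_commute)
qed

lemma trig_mult:
  assumes "\<phi> \<in> trig" "\<psi> \<in> trig"
  shows "(\<lambda>x. \<phi> x * \<psi> x) \<in> trig"
  using assms(1)
proof induction
  case (cos m n c)
  then show ?case using assms(2) by (rule trig_cos_mult)
next
  case (add \<phi> \<psi>)
  then show ?case by (simp add: distrib_right trig.add)
next
  case (scale \<phi> a)
  then show ?case using trig.scale[OF scale.IH, of a] by (simp add: mult.assoc)
qed

lemma trig_translate:
  assumes "\<phi> \<in> trig"
  shows "(\<lambda>x. \<phi> (x + v)) \<in> trig"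
  using assms
proof induction
  case (cos m n c)
  have eq: "of_int m * fst (x + v) + of_int n * snd (x + v) + c =
      of_int m * fst x + of_int n * snd x + (of_int m * fst v + of_int n * snd v + c)" for x
    by (simp add: algebra_simps)
  show ?case unfolding eq by (rule trig.cos)
qed (auto intro: trig.intros)

lemma trig_periodic:
  assumes "\<phi> \<in> trig"
  shows "\<phi> (x + (2 * pi * of_int k, 2 * pi * of_int l)) = \<phi> x"
  using assms
proof induction
  case (cos m n c)
  have "of_int m * fst (x + (2 * pi * of_int k, 2 * pi * of_int l)) +
      of_int n * snd (x + (2 * pi * of_int k, 2 * pi * of_int l)) + c =
      of_int m * fst x + of_int n * snd x + c + 2 * pi * of_int (m * k + n * l)"
    by (simp add: algebra_simps)
  then show ?case
    by (metis sin_cos_eq_iff)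
qed auto

lemma trig_has_derivative:
  assumes "\<phi> \<in> trig"
  shows "\<exists>D\<in>trig. \<exists>D'\<in>trig. \<forall>x. (\<phi> has_derivative (\<lambda>h. fst h * D x + snd h * D' x)) (at x)"
  using assms
proof induction
  case (cos m n c)
  have "((\<lambda>x. cos (of_int m * fst x + of_int n * snd x + c)) has_derivative
      (\<lambda>h. fst h * (of_int m * cos (of_int m * fst x + of_int n * snd x + (c + pi/2))) +
         snd h * (of_int n * cos (of_int m * fst x + of_int n * snd x + (c + pi/2))))) (at x)" for x :: "real \<times> real"
  proof -
    \<comment> \<open>The sine produced by differentiation is a cosine with phase advanced by
      \<open>pi/2\<close>, hence again a multiple of a generator.\<close>
    have "cos (of_int m * fst x + of_int n * snd x + (c + pi/2)) = - sin (of_int m * fst x + of_int n * snd x + c)"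
      using cos_add[of "of_int m * fst x + of_int n * snd x + c" "pi/2"] by (simp add: add.assoc)
    then show ?thesis
      by (auto intro!: derivative_eq_intros simp: algebra_simps)
  qed
  then show ?case
    by (intro bexI[of _ "\<lambda>x. of_int m * cos (of_int m * fst x + of_int n * snd x + (c + pi/2))"]
        bexI[of _ "\<lambda>x. of_int n * cos (of_int m * fst x + of_int n * snd x + (c + pi/2))"])
      (auto intro: trig.intros)
next
  case (add \<phi> \<psi>)
  then obtain A A' B B' where t: "A \<in> trig" "A' \<in> trig" "B \<in> trig" "B' \<in> trig"
    and d: "\<And>x. (\<phi> has_derivative (\<lambda>h. fst h * A x + snd h * A' x)) (at x)"
      "\<And>x. (\<psi> has_derivative (\<lambda>h. fst h * B x + snd h * B' x)) (at x)"
    by blast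
  have "((\<lambda>x. \<phi> x + \<psi> x) has_derivative
      (\<lambda>h. fst h * (A x + B x) + snd h * (A' x + B' x))) (at x)" for x
    using has_derivative_add[OF d(1)[of x] d(2)[of x]] by (simp add: algebra_simps)
  then show ?case
    by (intro bexI[of _ "\<lambda>x. A x + B x"] bexI[of _ "\<lambda>x. A' x + B' x"]) (auto intro: trig.add t)
next
  case (scale \<phi> a)
  then obtain A A' where t: "A \<in> trig" "A' \<in> trig"
    and d: "\<And>x. (\<phi> has_derivative (\<lambda>h. fst h * A x + snd h * A' x)) (at x)"
    by blast
  have "((\<lambda>x. a * \<phi> x) has_derivative (\<lambda>h. fst h * (a * A x) + snd h * (a * A' x))) (at x)" for x
    using has_derivative_mult_right[OF d, of a x] by (simp add: algebra_simps)
  then show ?case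
    by (intro bexI[of _ "\<lambda>x. a * A x"] bexI[of _ "\<lambda>x. a * A' x"]) (auto intro: trig.scale t)
qed

section \<open>Trigonometric polynomials as test functions\<close>

lemma partial_deriv_eq: "(\<phi> has_derivative D) (at x) \<Longrightarrow> partial_deriv e \<phi> x = D e"
  unfolding partial_deriv_def using frechet_derivative_at by fastforce

lemma trig_differentiable: "\<phi> \<in> trig \<Longrightarrow> \<phi> differentiable (at x)"
  using trig_has_derivative differentiable_def by blast

lemma trig_continuous_on: "\<phi> \<in> trig \<Longrightarrow> continuous_on A \<phi>"
  by (meson trig_differentiable differentiable_imp_continuous_within continuous_at_imp_continuous_on)

lemma partial_deriv_trig:
  assumes "\<phi> \<in> trig" and e: "e \<in> Basis"
  shows "partial_deriv e \<phi> \<in> trig"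
proof -
  obtain D D' where D: "D \<in> trig" "D' \<in> trig"
    "\<And>x. (\<phi> has_derivative (\<lambda>h. fst h * D x + snd h * D' x)) (at x)"
    using trig_has_derivative[OF assms(1)] by blast
  have "partial_deriv e \<phi> = (\<lambda>x. fst e * D x + snd e * D' x)"
    using partial_deriv_eq[OF D(3)] by blast
  then show ?thesis
    using D(1,2) by (auto intro: trig.intros)
qed

lemma trig_test_function:
  assumes "\<phi> \<in> trig"
  shows "torus_test_function \<phi>"
proof -
  have "C_k k \<phi>" if "\<phi> \<in> trig" for k \<phi>
    using that
    by (induction k arbitrary: \<phi>) (auto simp: trig_continuous_on trig_differentiable partial_deriv_trig)
  moreover have "\<phi> (x + (2 * pi) *\<^sub>R e) = \<phi> x" if "e \<in> Basis" for e x
    using that trig_periodic[OF assms, of x 1 0] trig_periodic[OF assms, of x 0 1]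
    by (auto simp: Basis_prod_def zero_prod_def)
  ultimately show ?thesis
    using assms unfolding torus_test_function_def by blast
qed

text \<open>By the fundamental theorem of calculus, the integral of \<open>\<phi>\<close> over the
  segment from \<open>x\<close> to \<open>x + a *\<^sub>R e\<close> has as its derivative along
  \<open>e\<close> the difference of the endpoint values. A finite difference of
  \<open>\<phi>\<close> thus becomes an exact derivative of a test function, to which the weak
  gradient applies.\<close>

lemma trig_segment_integral:
  assumes "\<phi> \<in> trig" "0 \<le> a" "e \<in> Basis"
  shows "\<exists>\<Psi>\<in>trig. (\<forall>x. ((\<lambda>t. \<phi> (x + t *\<^sub>R e)) has_integral \<Psi> x) {0..a}) \<and>
    (\<forall>x. \<exists>D. (\<Psi> has_derivative D) (at x) \<and> D e = \<phi> (x + a *\<^sub>R e) - \<phi> x)"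
  using assms(1)
proof induction
  case (cos m n c)
  \<comment> \<open>The frequency along \<open>e\<close>. If it vanishes, the generator is constant
    on the segment; otherwise it has an explicit antiderivative, a sine divided by
    \<open>k\<close>.\<close>
  define k where "k = (of_int m * fst e + of_int n * snd e :: real)"
  let ?u = "\<lambda>x. of_int m * fst x + of_int n * snd x + c :: real"
  have shift: "?u (x + t *\<^sub>R e) = ?u x + t * k" for x t
    by (simp add: k_def algebra_simps)
  show ?case
  proof (cases "k = 0")
    case True
    have "(\<lambda>x. a * cos (?u x)) \<in> trig"
      by (intro trig.intros)
    moreover have "((\<lambda>x. a * cos (?u x)) has_derivative
      (\<lambda>h. - a * sin (?u x) * (of_int m * fst h + of_int n * snd h))) (at x)" for x
      by (auto intro!: derivative_eq_intros simp: algebra_simps)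
    moreover have "((\<lambda>t. cos (?u (x + t *\<^sub>R e))) has_integral a * cos (?u x)) {0..a}" for x
      unfolding shift using True has_integral_const_real[of "cos (?u x)" 0 a] assms(2) by simp
    ultimately show ?thesis
      unfolding shift using True
      by (intro bexI[of _ "\<lambda>x. a * cos (?u x)"]) (auto simp flip: k_def simp: shift intro!: exI)
  next
    case False
    \<comment> \<open>The phase shifts by \<open>pi/2\<close> write the sines of the antiderivative
      as cosines, which makes membership in \<open>trig\<close> immediate.\<close>
    define \<Psi> where "\<Psi> = (\<lambda>x. 1/k * cos (?u x + (a * k - pi/2)) + (-1/k) * cos (?u x + (- pi/2)))"
    have "\<Psi> \<in> trig"
      unfolding \<Psi>_def add.assoc[of _ c] by (intro trig.intros)
    have \<Psi>: "\<Psi> x = sin (?u x + a * k) / k - sin (?u x + 0 * k) / k" for x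
    proof -
      have "cos (?u x + (a * k - pi/2)) = sin (?u x + a * k)" "cos (?u x + (- pi/2)) = sin (?u x)"
        using cos_diff[of "?u x + a * k" "pi/2"] cos_diff[of "?u x" "pi/2"] by (simp_all add: add_diff_eq)
      then show ?thesis
        using False by (simp add: \<Psi>_def field_simps)
    qed
    have "((\<lambda>t. cos (?u x + t * k)) has_integral \<Psi> x) {0..a}" for x
      unfolding \<Psi> using assms(2) False
      by (intro fundamental_theorem_of_calculus)
        (auto intro!: derivative_eq_intros simp flip: has_real_derivative_iff_has_vector_derivative)
    moreover have "\<exists>D. (\<Psi> has_derivative D) (at x) \<and> D e = cos (?u x + a * k) - cos (?u x)" for x
    proof (intro exI conjI)
      show "(\<Psi> has_derivative (\<lambda>h. (cos (?u x + a * k) - cos (?u x)) / k *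
          (of_int m * fst h + of_int n * snd h))) (at x)"
        unfolding \<Psi> using False
        by (auto intro!: derivative_eq_intros simp: field_simps)
    qed (use False in \<open>simp flip: k_def\<close>)
    ultimately show ?thesis
      unfolding shift using \<open>\<Psi> \<in> trig\<close> by blast
  qed
next
  case (add \<phi> \<psi>)
  then obtain A B where t: "A \<in> trig" "B \<in> trig"
    and i: "\<And>x. ((\<lambda>t. \<phi> (x + t *\<^sub>R e)) has_integral A x) {0..a}"
      "\<And>x. ((\<lambda>t. \<psi> (x + t *\<^sub>R e)) has_integral B x) {0..a}"
    and d: "\<And>x. \<exists>D. (A has_derivative D) (at x) \<and> D e = \<phi> (x + a *\<^sub>R e) - \<phi> x"
      "\<And>x. \<exists>D. (B has_derivative D) (at x) \<and> D e = \<psi> (x + a *\<^sub>R e) - \<psi> x"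
    by blast
  have "\<exists>D. ((\<lambda>x. A x + B x) has_derivative D) (at x) \<and>
      D e = (\<phi> (x + a *\<^sub>R e) + \<psi> (x + a *\<^sub>R e)) - (\<phi> x + \<psi> x)" for x
    using d(1)[of x] d(2)[of x]
    by (elim exE conjE) (rule exI, rule conjI, rule has_derivative_add, auto)
  with t i show ?case
    by (intro bexI[of _ "\<lambda>x. A x + B x"]) (auto intro!: has_integral_add trig.add)
next
  case (scale \<phi> b)
  then obtain A where t: "A \<in> trig"
    and i: "\<And>x. ((\<lambda>t. \<phi> (x + t *\<^sub>R e)) has_integral A x) {0..a}"
    and d: "\<And>x. \<exists>D. (A has_derivative D) (at x) \<and> D e = \<phi> (x + a *\<^sub>R e) - \<phi> x"
    by blast
  have "\<exists>D. ((\<lambda>x. b * A x) has_derivative D) (at x) \<and>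
      D e = b * \<phi> (x + a *\<^sub>R e) - b * \<phi> x" for x
    using d[of x]
    by (elim exE conjE) (rule exI, rule conjI, rule has_derivative_mult_right, auto simp: right_diff_distrib)
  with t i show ?case
    by (intro bexI[of _ "\<lambda>x. b * A x"]) (auto intro!: has_integral_mult_right trig.scale)
qed

section \<open>Translates and segment integrals\<close>

lemma torus_eq_cbox: "torus = cbox (-pi, -pi) (pi, pi)"
  by (simp add: torus_def cbox_Pair_eq)

lemma torus_sets [measurable]: "torus \<in> sets borel"
  by (simp add: torus_eq_cbox)

text \<open>Completion does not change nonnegative integrals. Passing to \<open>lborel\<close> makes
  Fubini's theorem and translation invariance available for Borel integrands.\<close>

lemma nn_integral_torus_measure:
  "(\<integral>\<^sup>+x. h x \<partial>torus_measure) = (\<integral>\<^sup>+x\<in>torus. h x \<partial>lborel)"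
  by (subst nn_integral_restrict_space) (auto simp: nn_integral_completion)

lemma trig_borel: "\<phi> \<in> trig \<Longrightarrow> \<phi> \<in> borel_measurable borel"
  by (simp add: borel_measurable_continuous_onI trig_continuous_on)

lemma nn_integral_lborel_translate:
  fixes h :: "'a::euclidean_space \<Rightarrow> ennreal"
  assumes [measurable]: "h \<in> borel_measurable borel"
  shows "(\<integral>\<^sup>+x. h (x + v) \<partial>lborel) = (\<integral>\<^sup>+x. h x \<partial>lborel)"
proof -
  have "(\<integral>\<^sup>+x. h x \<partial>lborel) = (\<integral>\<^sup>+x. h x \<partial>distr lborel borel ((+) v))"
    by (subst lborel_distr_plus) simp
  also have "\<dots> = (\<integral>\<^sup>+x. h (x + v) \<partial>lborel)"
    by (subst nn_integral_distr) (auto simp: add.commute)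
  finally show ?thesis by simp
qed

text \<open>Four copies of the torus shifted by multiples of \<open>2 * pi\<close>. Together they
  contain every translate of the torus by a vector with coordinates in
  \<open>{0..2 * pi}\<close>.\<close>

definition big_square :: "(real \<times> real) set" where
  "big_square = {- pi..3 * pi} \<times> {- pi..3 * pi}"

lemma big_square_eq_cbox: "big_square = cbox (-pi, -pi) (3 * pi, 3 * pi)"
  by (simp add: big_square_def cbox_Pair_eq)

lemma big_square_sets [measurable]: "big_square \<in> sets borel"
  by (simp add: big_square_eq_cbox)

lemma nn_integral_big_square_le:
  fixes h :: "real \<times> real \<Rightarrow> ennreal"
  assumes [measurable]: "h \<in> borel_measurable borel"
    and per: "\<And>x k l. h (x + (2 * pi * of_int k, 2 * pi * of_int l)) = h x"
  shows "(\<integral>\<^sup>+x\<in>big_square. h x \<partial>lborel) \<le> 4 * (\<integral>\<^sup>+x\<in>torus. h x \<partial>lborel)"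
proof -
  define w :: "int \<times> int \<Rightarrow> real \<times> real"
    where "w = (\<lambda>(k, l). (2 * pi * of_int k, 2 * pi * of_int l))"
  let ?I = "{0, 1} \<times> {0, 1} :: (int \<times> int) set"
  have ind: "indicator big_square x \<le> (\<Sum>i\<in>?I. indicator torus (x - w i) :: ennreal)" for x
  proof (cases "x \<in> big_square")
    case True
    \<comment> \<open>Records, for each coordinate, whether a shift by \<open>2 * pi\<close> is
      needed to return to the fundamental interval.\<close>
    define k :: "real \<Rightarrow> int" where "k = (\<lambda>t. if t \<le> pi then 0 else 1)"
    have "x - w (k (fst x), k (snd x)) \<in> torus" and I: "(k (fst x), k (snd x)) \<in> ?I"
      using True by (auto simp: big_square_def torus_def w_def k_def mem_Times_iff)
    then have "1 = (indicator torus (x - w (k (fst x), k (snd x))) :: ennreal)"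
      by simp
    also have "\<dots> \<le> (\<Sum>i\<in>?I. indicator torus (x - w i))"
      by (rule member_le_sum[OF I]) auto
    finally show ?thesis
      using True by simp
  qed simp
  have "(\<integral>\<^sup>+x\<in>big_square. h x \<partial>lborel) \<le> (\<integral>\<^sup>+x. (\<Sum>i\<in>?I. h x * indicator torus (x - w i)) \<partial>lborel)"
    by (intro nn_integral_mono) (simp only: sum_distrib_left[symmetric] mult_left_mono[OF ind] zero_le)
  also have "\<dots> = (\<Sum>i\<in>?I. \<integral>\<^sup>+x. h x * indicator torus (x - w i) \<partial>lborel)"
    by (rule nn_integral_sum) measurable
  also have "\<dots> = (\<Sum>i\<in>?I. \<integral>\<^sup>+x\<in>torus. h x \<partial>lborel)"
  proof (rule sum.cong[OF refl])
    fix i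
    \<comment> \<open>Translation by \<open>w i\<close> carries the indicator back to the
      fundamental square, and periodicity leaves \<open>h\<close> unchanged.\<close>
    have "(\<integral>\<^sup>+x. h x * indicator torus (x - w i) \<partial>lborel) =
        (\<integral>\<^sup>+x. h (x + w i) * indicator torus (x + w i - w i) \<partial>lborel)"
      by (rule nn_integral_lborel_translate[symmetric]) measurable
    then show "(\<integral>\<^sup>+x. h x * indicator torus (x - w i) \<partial>lborel) = (\<integral>\<^sup>+x\<in>torus. h x \<partial>lborel)"
      by (simp add: w_def per split: prod.splits)
  qed
  also have "\<dots> = 4 * (\<integral>\<^sup>+x\<in>torus. h x \<partial>lborel)"
    by simp
  finally show ?thesis .
qed

text \<open>The translated square lies in \<open>big_square\<close>, which consists of four periods;
  the crude factor 4 affects only constants.\<close>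

lemma nn_integral_trig_translate_le:
  assumes "\<phi> \<in> trig" "fst v \<in> {0..2 * pi}" "snd v \<in> {0..2 * pi}"
  shows "(\<integral>\<^sup>+x\<in>torus. ennreal ((\<phi> (x + v))\<^sup>2) \<partial>lborel) \<le> 4 * (\<integral>\<^sup>+x\<in>torus. ennreal ((\<phi> x)\<^sup>2) \<partial>lborel)"
proof -
  note [measurable] = trig_borel[OF assms(1)]
  have "(\<integral>\<^sup>+x\<in>torus. ennreal ((\<phi> (x + v))\<^sup>2) \<partial>lborel) \<le>
      (\<integral>\<^sup>+x. ennreal ((\<phi> (x + v))\<^sup>2) * indicator big_square (x + v) \<partial>lborel)"
    using assms(2,3)
    by (intro nn_integral_mono mult_left_mono)
      (auto simp: torus_def big_square_def indicator_def mem_Times_iff)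
  also have "\<dots> = (\<integral>\<^sup>+x\<in>big_square. ennreal ((\<phi> x)\<^sup>2) \<partial>lborel)"
    by (rule nn_integral_lborel_translate) measurable
  also have "\<dots> \<le> 4 * (\<integral>\<^sup>+x\<in>torus. ennreal ((\<phi> x)\<^sup>2) \<partial>lborel)"
    by (rule nn_integral_big_square_le) (auto simp: trig_periodic[OF assms(1)])
  finally show ?thesis .
qed

text \<open>Cauchy--Schwarz against the constant 1, with the right-hand side as a nonnegative
  integral ready for Fubini's theorem.\<close>

lemma integral_square_le:
  fixes h :: "real \<Rightarrow> real"
  assumes h: "continuous_on {0..a} h" "(h has_integral I) {0..a}" and a: "0 \<le> a"
  shows "ennreal (I\<^sup>2) \<le> ennreal a * (\<integral>\<^sup>+t\<in>{0..a}. ennreal ((h t)\<^sup>2) \<partial>lborel)"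
proof -
  obtain J where J: "((\<lambda>t. (h t)\<^sup>2) has_integral J) {0..a}"
    using integrable_continuous_interval[of 0 a "\<lambda>t. (h t)\<^sup>2"] h(1)
    by (auto intro!: continuous_intros simp: integrable_on_def)
  \<comment> \<open>The integrand is \<open>(a * h t - I)\<^sup>2\<close> expanded, and its integral
    equals \<open>a * (a * J - I\<^sup>2)\<close>.\<close>
  have "((\<lambda>t. a\<^sup>2 * (h t)\<^sup>2 - 2 * a * I * h t + I\<^sup>2) has_integral
      (a\<^sup>2 * J - 2 * a * I * I + a * I\<^sup>2)) {0..a}"
    using has_integral_const_real[of "I\<^sup>2" 0 a] a
    by (intro has_integral_add has_integral_diff has_integral_mult_right J h) simp
  then have "0 \<le> a\<^sup>2 * J - 2 * a * I * I + a * I\<^sup>2"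
  proof (rule has_integral_nonneg)
    show "0 \<le> a\<^sup>2 * (h t)\<^sup>2 - 2 * a * I * h t + I\<^sup>2" for t
      using zero_le_power2[of "a * h t - I"] by (simp add: power2_eq_square algebra_simps)
  qed
  then have "0 \<le> a * (a * J - I\<^sup>2)"
    by (simp add: power2_eq_square algebra_simps)
  then have "I\<^sup>2 \<le> a * J"
  proof (cases "a = 0")
    case True
    then have "I = 0" using h(2) by (simp add: has_integral_refl(1) has_integral_iff)
    with True show ?thesis by simp
  next
    case False
    then show ?thesis using \<open>0 \<le> a * (a * J - I\<^sup>2)\<close> a by (simp add: zero_le_mult_iff)
  qed
  moreover have "(\<integral>\<^sup>+t\<in>{0..a}. ennreal ((h t)\<^sup>2) \<partial>lborel) = ennreal J"
  proof -
    have "(\<integral>\<^sup>+t\<in>{0..a}. ennreal ((h t)\<^sup>2) \<partial>lborel) = (\<integral>\<^sup>+t. ennreal (indicator {0..a} t * (h t)\<^sup>2) \<partial>lborel)"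
      by (intro nn_integral_cong) (auto simp: indicator_def)
    also have "\<dots> = ennreal J"
      by (rule nn_integral_has_integral_lebesgue[OF _ J]) simp
    finally show ?thesis .
  qed
  ultimately show ?thesis
    using a by (simp add: ennreal_mult''[symmetric] ennreal_leI has_integral_nonneg[OF J] flip: ennreal_mult)
qed

text \<open>Cauchy--Schwarz on each segment costs one factor \<open>a\<close>, the translation bound
  costs 4 for each \<open>t\<close> after Fubini, and integration over \<open>t\<close> gives the
  second factor \<open>a\<close>.\<close>

lemma trig_segment_integral_norm_le:
  assumes \<phi>: "\<phi> \<in> trig" and a: "0 \<le> a" "a \<le> 2 * pi" and e: "e \<in> Basis"
    and \<Psi>: "\<Psi> \<in> trig" "\<And>x. ((\<lambda>t. \<phi> (x + t *\<^sub>R e)) has_integral \<Psi> x) {0..a}"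
  shows "(\<integral>\<^sup>+x\<in>torus. ennreal ((\<Psi> x)\<^sup>2) \<partial>lborel) \<le>
    ennreal (4 * a\<^sup>2) * (\<integral>\<^sup>+x\<in>torus. ennreal ((\<phi> x)\<^sup>2) \<partial>lborel)"
proof -
  note [measurable] = trig_borel[OF \<phi>]
  let ?N = "\<integral>\<^sup>+x\<in>torus. ennreal ((\<phi> x)\<^sup>2) \<partial>lborel"
  have "(\<integral>\<^sup>+x\<in>torus. ennreal ((\<Psi> x)\<^sup>2) \<partial>lborel) \<le>
      (\<integral>\<^sup>+x. \<integral>\<^sup>+t. ennreal a * (ennreal ((\<phi> (x + t *\<^sub>R e))\<^sup>2) * indicator {0..a} t * indicator torus x) \<partial>lborel \<partial>lborel)"
  proof (intro nn_integral_mono)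
    fix x
    have "ennreal ((\<Psi> x)\<^sup>2) \<le> ennreal a * (\<integral>\<^sup>+t\<in>{0..a}. ennreal ((\<phi> (x + t *\<^sub>R e))\<^sup>2) \<partial>lborel)"
      by (rule integral_square_le[OF _ \<Psi>(2) a(1)])
        (intro continuous_on_compose2[OF trig_continuous_on[OF \<phi>, of UNIV]] continuous_intros, auto)
    also have "\<dots> = (\<integral>\<^sup>+t. ennreal a * (ennreal ((\<phi> (x + t *\<^sub>R e))\<^sup>2) * indicator {0..a} t) \<partial>lborel)"
      by (rule nn_integral_cmult[symmetric]) measurable
    finally show "ennreal ((\<Psi> x)\<^sup>2) * indicator torus x \<le>
      (\<integral>\<^sup>+t. ennreal a * (ennreal ((\<phi> (x + t *\<^sub>R e))\<^sup>2) * indicator {0..a} t * indicator torus x) \<partial>lborel)"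
      by (auto simp: indicator_def)
  qed
  also have "\<dots> = (\<integral>\<^sup>+t. \<integral>\<^sup>+x. ennreal a * (ennreal ((\<phi> (x + t *\<^sub>R e))\<^sup>2) * indicator {0..a} t * indicator torus x) \<partial>lborel \<partial>lborel)"
    by (rule lborel_pair.Fubini') measurable
  also have "\<dots> \<le> (\<integral>\<^sup>+t. ennreal a * (4 * ?N) * indicator {0..a} t \<partial>lborel)"
  proof (intro nn_integral_mono)
    fix t
    show "(\<integral>\<^sup>+x. ennreal a * (ennreal ((\<phi> (x + t *\<^sub>R e))\<^sup>2) * indicator {0..a} t * indicator torus x) \<partial>lborel) \<le>
      ennreal a * (4 * ?N) * indicator {0..a} t"
    proof (cases "t \<in> {0..a}")
      case True
      have "fst (t *\<^sub>R e) \<in> {0..2 * pi}" "snd (t *\<^sub>R e) \<in> {0..2 * pi}"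
        using True a e by (auto simp: Basis_prod_def)
      from nn_integral_trig_translate_le[OF \<phi> this] True show ?thesis
        by (subst nn_integral_cmult) (measurable, auto intro: mult_left_mono)
    qed simp
  qed
  also have "\<dots> = ennreal a * (4 * ?N) * ennreal a"
    using a by (subst nn_integral_cmult_indicator) auto
  also have "\<dots> = ennreal (4 * a\<^sup>2) * ?N"
    using a by (simp add: ennreal_mult power2_eq_square mult_ac)
  finally show ?thesis .
qed

section \<open>Density of trigonometric polynomials in \<open>L\<^sup>2\<close>\<close>

text \<open>Vanishing on the edges gives \<open>u\<close> equal values at identified points, which
  any uniform limit of periodic functions must have.\<close>

lemma trig_uniform_approx:
  fixes u :: "real \<times> real \<Rightarrow> real"
  assumes u: "continuous_on torus u" and \<epsilon>: "0 < \<epsilon>"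
    and u0: "\<And>x. x \<in> torus \<Longrightarrow> \<bar>fst x\<bar> = pi \<or> \<bar>snd x\<bar> = pi \<Longrightarrow> u x = 0"
  shows "\<exists>\<phi>\<in>trig. \<forall>x\<in>torus. \<bar>u x - \<phi> x\<bar> < \<epsilon>"
proof -
  define p :: "real \<times> real \<Rightarrow> real \<times> real \<times> real \<times> real"
    where "p x = (cos (fst x), sin (fst x), cos (snd x), sin (snd x))" for x
  define S where "S = p ` torus"
  have p: "continuous_on A p" for A
    unfolding p_def by (intro continuous_intros)
  have compact_torus: "compact torus"
    by (simp add: torus_eq_cbox)
  then have "compact S"
    unfolding S_def by (intro compact_continuous_image p)
  \<comment> \<open>The two angles differ by \<open>2 * pi * n\<close> with \<open>n\<close> in
    \<open>{-1, 0, 1}\<close>, so they agree or are opposite endpoints.\<close>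
  have circle: "s = t \<or> \<bar>s\<bar> = pi \<and> \<bar>t\<bar> = pi"
    if st: "cos s = cos t" "sin s = sin t" "s \<in> {-pi..pi}" "t \<in> {-pi..pi}" for s t
  proof -
    obtain n :: int where n: "s = t + 2 * pi * n"
      using st(1,2) sin_cos_eq_iff by metis
    have "2 * pi * \<bar>real_of_int n\<bar> = \<bar>s - t\<bar>"
      using n by (simp add: abs_mult)
    also have "\<dots> \<le> 2 * pi * 1"
      using st(3,4) by (simp add: abs_le_iff)
    finally have "\<bar>n\<bar> \<le> 1"
      using mult_le_cancel_left_pos[of "2 * pi" "\<bar>real_of_int n\<bar>" 1] by simp
    then have "n \<in> {-1, 0, 1}"
      by auto
    then show ?thesis
      using n st(3,4) by auto
  qed
  \<comment> \<open>\<open>u\<close> factors through the circle coordinates \<open>p\<close>, which separate the points of the torus, so that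
    the Stone--Weierstrass theorem applies on the image of \<open>p\<close>.\<close>
  have fibre: "u x = u y" if "x \<in> torus" "y \<in> torus" "p x = p y" for x y
  proof (cases "x = y")
    case False
    have "cos (fst x) = cos (fst y)" "sin (fst x) = sin (fst y)" "cos (snd x) = cos (snd y)" "sin (snd x) = sin (snd y)"
      using that(3) by (simp_all add: p_def)
    moreover have "fst x \<in> {-pi..pi}" "fst y \<in> {-pi..pi}" "snd x \<in> {-pi..pi}" "snd y \<in> {-pi..pi}"
      using that(1,2) by (simp_all add: torus_def mem_Times_iff)
    ultimately have "fst x = fst y \<or> \<bar>fst x\<bar> = pi \<and> \<bar>fst y\<bar> = pi" "snd x = snd y \<or> \<bar>snd x\<bar> = pi \<and> \<bar>snd y\<bar> = pi"
      using circle by blast+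
    then have "(\<bar>fst x\<bar> = pi \<or> \<bar>snd x\<bar> = pi) \<and> (\<bar>fst y\<bar> = pi \<or> \<bar>snd y\<bar> = pi)"
      using False prod_eq_iff by blast
    then show ?thesis
      using u0[OF that(1)] u0[OF that(2)] by argo
  qed simp
  define U where "U q = u (SOME x. x \<in> torus \<and> p x = q)" for q
  have U: "U (p x) = u x" if "x \<in> torus" for x
    unfolding U_def by (rule someI2[of _ x]) (use that fibre in blast)+
  \<comment> \<open>The compact torus maps onto \<open>S\<close> as a quotient: the preimage of a
    closed set under \<open>U\<close> is the image under \<open>p\<close> of its compact preimage
    under \<open>u\<close>.\<close>
  have "continuous_on S U"
  proof (subst continuous_on_closed_vimage)
    show "closed S"
      by (rule compact_imp_closed) fact
    show "\<forall>B. closed B \<longrightarrow> closed (U -` B \<inter> S)"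
    proof (intro allI impI)
      fix B :: "real set" assume "closed B"
      have "closed (u -` B \<inter> torus)"
        using continuous_on_closed_vimage[OF compact_imp_closed[OF compact_torus]] u \<open>closed B\<close> by blast
      then have "compact (torus \<inter> (u -` B \<inter> torus))"
        using compact_torus by (rule compact_Int_closed[rotated])
      then have "compact (p ` (torus \<inter> (u -` B \<inter> torus)))"
        by (intro compact_continuous_image p)
      moreover have "p ` (torus \<inter> (u -` B \<inter> torus)) = U -` B \<inter> S"
        by (auto simp: S_def U intro!: imageI)
      ultimately show "closed (U -` B \<inter> S)"
        by (simp add: compact_imp_closed)
    qed
  qed
  \<comment> \<open>The algebra for Stone--Weierstrass: continuous functions on \<open>S\<close>
    whose pullback along \<open>p\<close> is a trigonometric polynomial. The four coordinates belong
    to it and separate points.\<close>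
  define P where "P F \<longleftrightarrow> continuous_on S F \<and> (\<lambda>x. F (p x)) \<in> trig" for F :: "real \<times> real \<times> real \<times> real \<Rightarrow> real"
  have coords: "P fst" "P (\<lambda>q. fst (snd q))" "P (\<lambda>q. fst (snd (snd q)))" "P (\<lambda>q. snd (snd (snd q)))"
    using trig.cos[of 1 0 0] trig.cos[of 0 1 0] trig.cos[of 1 0 "- (pi/2)"] trig.cos[of 0 1 "- (pi/2)"]
    by (auto simp: P_def p_def cos_diff intro!: continuous_intros)
  have "\<exists>F. P F \<and> (\<forall>q\<in>S. \<bar>U q - F q\<bar> < \<epsilon>)"
  proof (rule Stone_Weierstrass_HOL)
    show "P (\<lambda>q. c)" for c
      by (simp add: P_def trig_const)
    fix q q' assume "q \<in> S \<and> q' \<in> S \<and> q \<noteq> q'"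
    then have "fst q \<noteq> fst q' \<or> fst (snd q) \<noteq> fst (snd q') \<or> fst (snd (snd q)) \<noteq> fst (snd (snd q')) \<or>
        snd (snd (snd q)) \<noteq> snd (snd (snd q'))"
      by (auto simp: prod_eq_iff)
    with coords show "\<exists>F. P F \<and> F q \<noteq> F q'"
      by blast
  qed (use \<open>compact S\<close> \<open>continuous_on S U\<close> \<epsilon> in
      \<open>auto simp: P_def intro!: continuous_intros trig.add trig_mult\<close>)
  then obtain F where F: "P F" "\<And>q. q \<in> S \<Longrightarrow> \<bar>U q - F q\<bar> < \<epsilon>"
    by blast
  then show ?thesis
    by (intro bexI[of _ "\<lambda>x. F (p x)"]) (auto simp: P_def S_def U[symmetric])
qed

section \<open>Square-integrable functions on the torus\<close>

lemma borel_measurable_torus_measure: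
  "h \<in> borel_measurable borel \<Longrightarrow> h \<in> borel_measurable torus_measure"
  by (simp add: measurable_completion measurable_restrict_space1)

lemma finite_torus_measure: "finite_measure torus_measure"
  by (rule finite_measureI) (use emeasure_lborel_cbox_finite[of "(-pi, -pi)" "(pi, pi)"] in
      \<open>simp add: emeasure_restrict_space torus_eq_cbox space_restrict_space\<close>)

lemma AE_torus_measure_I:
  assumes "negligible N" "\<And>x. x \<in> torus \<Longrightarrow> x \<notin> N \<Longrightarrow> P x"
  shows "AE x in torus_measure. P x"
proof -
  have "AE x in lebesgue. x \<notin> N"
    using assms(1) by (intro AE_not_in) (simp add: negligible_iff_null_sets)
  then show ?thesis
    by (subst AE_restrict_space_iff) (auto simp: assms(2) elim!: eventually_mono)
qed

lemma in_L2_mult_integrable: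
  fixes f h :: "real \<times> real \<Rightarrow> real"
  assumes "in_L2 f" "in_L2 h"
  shows "integrable torus_measure (\<lambda>x. f x * h x)"
proof (rule Bochner_Integration.integrable_bound)
  show "integrable torus_measure (\<lambda>x. (f x)\<^sup>2 + (h x)\<^sup>2)"
    using assms by (auto simp: in_L2_def)
  show "(\<lambda>x. f x * h x) \<in> borel_measurable torus_measure"
    using assms by (auto simp: in_L2_def)
  have "\<bar>f x * h x\<bar> \<le> (f x)\<^sup>2 + (h x)\<^sup>2" for x
    using sum_squares_bound[of "\<bar>f x\<bar>" "\<bar>h x\<bar>"]
      mult_nonneg_nonneg[of "\<bar>f x\<bar>" "\<bar>h x\<bar>"]
    unfolding abs_mult power2_abs by linarith
  then show "AE x in torus_measure. norm (f x * h x) \<le> norm ((f x)\<^sup>2 + (h x)\<^sup>2)"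
    by (intro AE_I2) auto
qed

lemma in_L2_diff:
  fixes f h :: "real \<times> real \<Rightarrow> real"
  assumes "in_L2 f" "in_L2 h"
  shows "in_L2 (\<lambda>x. f x - h x)"
proof -
  have "integrable torus_measure (\<lambda>x. (f x)\<^sup>2 + (h x)\<^sup>2 - 2 * (f x * h x))"
    using assms in_L2_mult_integrable[OF assms]
    by (intro Bochner_Integration.integrable_diff Bochner_Integration.integrable_add integrable_mult_right)
      (simp_all add: in_L2_def)
  then have "integrable torus_measure (\<lambda>x. (norm (f x - h x))\<^sup>2)"
    by (simp add: power2_diff mult.assoc)
  then show ?thesis
    using assms unfolding in_L2_def by (blast intro: borel_measurable_diff)
qed

lemma bounded_in_L2:
  fixes f :: "real \<times> real \<Rightarrow> real"
  assumes "f \<in> borel_measurable torus_measure" "\<And>x. x \<in> torus \<Longrightarrow> \<bar>f x\<bar> \<le> B"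
  shows "in_L2 f"
proof -
  interpret finite_measure torus_measure by (rule finite_torus_measure)
  have "integrable torus_measure (\<lambda>x. (f x)\<^sup>2)"
  proof (rule integrable_const_bound)
    have "(f x)\<^sup>2 \<le> B\<^sup>2" if "x \<in> torus" for x
      using power_mono[OF assms(2)[OF that], of 2] by simp
    then show "AE x in torus_measure. norm ((f x)\<^sup>2) \<le> B\<^sup>2"
      by (intro AE_I2) (simp add: space_restrict_space)
  qed (use assms(1) in simp)
  with assms show ?thesis
    by (simp add: in_L2_def)
qed

lemma continuous_in_L2:
  fixes f :: "real \<times> real \<Rightarrow> real"
  assumes "continuous_on UNIV f"
  shows "in_L2 f"
proof -
  have "compact (f ` torus)"
    using assms by (intro compact_continuous_image) (auto simp: torus_eq_cbox intro: continuous_on_subset)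
  then obtain B where "\<forall>y\<in>f ` torus. norm y \<le> B"
    using compact_imp_bounded bounded_iff by blast
  then have "\<And>x. x \<in> torus \<Longrightarrow> \<bar>f x\<bar> \<le> B"
    by simp
  then show ?thesis
    using bounded_in_L2 borel_measurable_torus_measure borel_measurable_continuous_onI assms by blast
qed

lemma trig_in_L2: "\<phi> \<in> trig \<Longrightarrow> in_L2 \<phi>"
  by (simp add: continuous_in_L2 trig_continuous_on)

text \<open>Three approximations are chained: truncation at height \<open>k\<close>, bounded
  continuous functions vanishing on the edges, and uniform approximation by trigonometric
  polynomials. Each squared error is below \<open>\<epsilon> / 9\<close>, since \<open>sq\<close>
  puts a factor 3 on each of the three terms.\<close>

lemma trig_L2_dense:
  fixes f :: "real \<times> real \<Rightarrow> real"
  assumes f: "in_L2 f" and \<epsilon>: "0 < \<epsilon>"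
  shows "\<exists>\<phi>\<in>trig. (\<integral>x. (f x - \<phi> x)\<^sup>2 \<partial>torus_measure) < \<epsilon>"
proof -
  interpret finite_measure torus_measure by (rule finite_torus_measure)
  let ?M = torus_measure
  have fm [measurable]: "f \<in> borel_measurable ?M" and fi: "integrable ?M (\<lambda>x. (f x)\<^sup>2)"
    using f by (auto simp: in_L2_def)
  define c where "c k y = max (- k) (min k y)" for k y :: real
  have c_measurable [measurable]: "c k \<in> borel_measurable borel" for k
    unfolding c_def by measurable
  have c_bound: "\<bar>c k y\<bar> \<le> k" if "0 \<le> k" for k y
    using that by (auto simp: c_def)
  have c_cont: "isCont (c k) y" for k y
    unfolding c_def by (intro continuous_intros)

  \<comment> \<open>At each point the truncation error is eventually zero, and its square is
    dominated by that of \<open>f\<close>.\<close>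
  have "(\<lambda>k. \<integral>x. (f x - c (real k) (f x))\<^sup>2 \<partial>?M) \<longlonglongrightarrow> (\<integral>x. 0 \<partial>?M)"
  proof (rule integral_dominated_convergence[OF _ _ fi])
    show "AE x in ?M. (\<lambda>k. (f x - c (real k) (f x))\<^sup>2) \<longlonglongrightarrow> 0"
    proof (intro AE_I2 tendsto_eventually)
      fix x
      show "\<forall>\<^sub>F k in sequentially. (f x - c (real k) (f x))\<^sup>2 = 0"
        using eventually_ge_at_top[of "nat \<lceil>\<bar>f x\<bar>\<rceil>"]
        by eventually_elim (auto simp: c_def max_def min_def; linarith)
    qed
    show "AE x in ?M. norm ((f x - c (real k) (f x))\<^sup>2) \<le> (f x)\<^sup>2" for k
      by (intro AE_I2) (auto simp: c_def max_def min_def abs_le_square_iff[symmetric])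
  qed measurable
  then have "\<forall>\<^sub>F k in sequentially. (\<integral>x. (f x - c (real k) (f x))\<^sup>2 \<partial>?M) < \<epsilon> / 9"
    by (rule order_tendstoD) (use \<epsilon> in simp)
  then obtain k :: nat where k: "(\<integral>x. (f x - c (real k) (f x))\<^sup>2 \<partial>?M) < \<epsilon> / 9"
    by (auto simp: eventually_sequentially)

  \<comment> \<open>Measurability supplies continuous functions \<open>g n\<close> that converge to
    \<open>f\<close> on the torus off a negligible set.\<close>
  have "f measurable_on torus"
    by (subst measurable_on_iff_borel_measurable) (auto simp: fm)
  then obtain N g where N: "negligible N" and g: "\<And>n. continuous_on UNIV (g n)"
    and gf: "\<And>x. x \<notin> N \<Longrightarrow> (\<lambda>n. g n x) \<longlonglongrightarrow> (if x \<in> torus then f x else 0)"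
    unfolding measurable_on_def by blast
  \<comment> \<open>A cutoff vanishing on the boundary of the square makes the approximants periodic.\<close>
  define \<eta> where "\<eta> n x = min 1 (real n * ((1 + cos (fst x)) * (1 + cos (snd x))))" for n and x :: "real \<times> real"
  have \<eta>_bound: "\<eta> n x \<in> {0..1}" for n x
  proof -
    have "0 \<le> 1 + cos (fst x)" "0 \<le> 1 + cos (snd x)"
      using cos_ge_minus_one[of "fst x"] cos_ge_minus_one[of "snd x"] by linarith+
    then show ?thesis
      by (simp add: \<eta>_def)
  qed
  define u where "u n x = c k (g n x) * \<eta> n x" for n x
  have u_cont: "continuous_on UNIV (u n)" for n
    unfolding u_def \<eta>_def c_def by (intro continuous_intros g)
  then have u_meas [measurable]: "u n \<in> borel_measurable ?M" for n
    by (intro borel_measurable_torus_measure borel_measurable_continuous_onI)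
  have u_bound: "\<bar>u n x\<bar> \<le> k" for n x
    using mult_mono[OF c_bound[of "real k" "g n x"], of "\<eta> n x" 1] \<eta>_bound[of n x]
    by (simp add: u_def abs_mult)
  have "(\<lambda>n. \<integral>x. (c k (f x) - u n x)\<^sup>2 \<partial>?M) \<longlonglongrightarrow> (\<integral>x. 0 \<partial>?M)"
  proof (rule integral_dominated_convergence[where w = "\<lambda>_. (2 * real k)\<^sup>2"])
    show "AE x in ?M. (\<lambda>n. (c k (f x) - u n x)\<^sup>2) \<longlonglongrightarrow> 0"
    proof (rule AE_torus_measure_I)
      \<comment> \<open>The edges join the exceptional set because the cutoff is zero there; at
        interior points it is eventually 1.\<close>
      show "negligible (N \<union> (cbox (-pi, -pi) (pi, pi) - box (-pi, -pi) (pi, pi)) :: (real \<times> real) set)"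
        by (intro negligible_Un N negligible_frontier_interval)
      fix x :: "real \<times> real" assume x: "x \<in> torus" "x \<notin> N \<union> (cbox (-pi, -pi) (pi, pi) - box (-pi, -pi) (pi, pi))"
      then have "x \<in> box (-pi, -pi) (pi, pi)"
        by (auto simp: torus_eq_cbox)
      then have "\<bar>fst x\<bar> < pi" "\<bar>snd x\<bar> < pi"
        by (auto simp: box_def Basis_prod_def inner_prod_def)
      then have "cos pi < cos \<bar>fst x\<bar>" "cos pi < cos \<bar>snd x\<bar>"
        by (auto simp del: cos_abs_real cos_pi intro!: cos_monotone_0_pi)
      then have pos: "0 < (1 + cos (fst x)) * (1 + cos (snd x))" (is "0 < ?q")
        by simp
      have "\<forall>\<^sub>F n in sequentially. \<eta> n x = 1"
        using eventually_ge_at_top[of "nat \<lceil>1 / ?q\<rceil>"]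
      proof eventually_elim
        case (elim n)
        then have "1 / ?q \<le> real n" by linarith
        then show ?case
          using pos by (simp add: \<eta>_def divide_le_eq)
      qed
      then have "(\<lambda>n. \<eta> n x) \<longlonglongrightarrow> 1"
        by (rule tendsto_eventually)
      moreover have "(\<lambda>n. c k (g n x)) \<longlonglongrightarrow> c k (f x)"
        using gf[of x] x by (intro isCont_tendsto_compose[OF c_cont]) simp
      ultimately have "(\<lambda>n. (c k (f x) - u n x)\<^sup>2) \<longlonglongrightarrow> (c k (f x) - c k (f x) * 1)\<^sup>2"
        unfolding u_def by (intro tendsto_intros)
      then show "(\<lambda>n. (c k (f x) - u n x)\<^sup>2) \<longlonglongrightarrow> 0"
        by simp
    qed
    have "\<bar>c k (f x) - u n x\<bar> \<le> \<bar>2 * real k\<bar>" for n x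
      using c_bound[of k "f x"] u_bound[of n x] by simp
    then show "AE x in ?M. norm ((c k (f x) - u n x)\<^sup>2) \<le> (2 * real k)\<^sup>2" for n
      by (intro AE_I2) (simp only: real_norm_def abs_power2 abs_le_square_iff[symmetric])
  qed auto
  then have "\<forall>\<^sub>F n in sequentially. (\<integral>x. (c k (f x) - u n x)\<^sup>2 \<partial>?M) < \<epsilon> / 9"
    by (rule order_tendstoD) (use \<epsilon> in simp)
  then obtain n where n: "(\<integral>x. (c k (f x) - u n x)\<^sup>2 \<partial>?M) < \<epsilon> / 9"
    by (auto simp: eventually_sequentially)

  \<comment> \<open>The added 1 keeps the denominator positive and makes
    \<open>\<delta>\<^sup>2\<close> times the area of the torus strictly less than
    \<open>\<epsilon> / 9\<close>.\<close>
  define \<delta> where "\<delta> = sqrt (\<epsilon> / (9 * (1 + measure ?M (space ?M))))"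
  have \<delta>: "0 < \<delta>" "\<delta>\<^sup>2 * (1 + measure ?M (space ?M)) = \<epsilon> / 9"
    using \<epsilon> by (auto simp: \<delta>_def add_pos_nonneg) (simp add: field_simps add_nonneg_eq_0_iff)
  have "u n x = 0" if "\<bar>fst x\<bar> = pi \<or> \<bar>snd x\<bar> = pi" for x
  proof -
    have "cos \<bar>fst x\<bar> = -1 \<or> cos \<bar>snd x\<bar> = -1"
      using that by (metis cos_pi)
    then show ?thesis
      by (auto simp: u_def \<eta>_def)
  qed
  then obtain \<phi> where \<phi>: "\<phi> \<in> trig" "\<And>x. x \<in> torus \<Longrightarrow> \<bar>u n x - \<phi> x\<bar> < \<delta>"
    using trig_uniform_approx[of "u n" \<delta>] u_cont \<delta>(1) continuous_on_subset by blast
  have L2: "in_L2 (\<lambda>x. c k (f x))" "in_L2 (u n)" "in_L2 \<phi>"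
    using c_bound[of k] u_bound[of n] trig_in_L2[OF \<phi>(1)] by (auto intro!: bounded_in_L2[of _ k])
  note i = in_L2_diff[OF f L2(1)] in_L2_diff[OF L2(1,2)] in_L2_diff[OF L2(2,3)] in_L2_diff[OF f L2(3)]
  have "(\<integral>x. (u n x - \<phi> x)\<^sup>2 \<partial>?M) \<le> (\<integral>x. \<delta>\<^sup>2 \<partial>?M)"
  proof (rule integral_mono_AE)
    show "AE x in ?M. (u n x - \<phi> x)\<^sup>2 \<le> \<delta>\<^sup>2"
      using \<phi>(2) \<delta>(1)
      by (intro AE_I2) (auto simp: space_restrict_space abs_le_square_iff[symmetric] intro: less_imp_le)
  qed (use i in \<open>auto simp: in_L2_def\<close>)
  also have "\<dots> < \<epsilon> / 9"
    using \<delta>(1) by (simp add: algebra_simps flip: \<delta>(2))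
  finally have s: "(\<integral>x. (u n x - \<phi> x)\<^sup>2 \<partial>?M) < \<epsilon> / 9" .
  have sq: "(a - d)\<^sup>2 \<le> 3 * (a - b)\<^sup>2 + 3 * (b - c)\<^sup>2 + 3 * (c - d)\<^sup>2" for a b c d :: real
  proof -
    have "0 \<le> ((a - b) - (b - c))\<^sup>2 + ((b - c) - (c - d))\<^sup>2 + ((a - b) - (c - d))\<^sup>2"
      by simp
    then show ?thesis
      by (simp add: power2_eq_square algebra_simps)
  qed
  have "(\<integral>x. (f x - \<phi> x)\<^sup>2 \<partial>?M) \<le>
      (\<integral>x. 3 * (f x - c k (f x))\<^sup>2 + 3 * (c k (f x) - u n x)\<^sup>2 + 3 * (u n x - \<phi> x)\<^sup>2 \<partial>?M)"
    using i sq by (intro integral_mono) (auto simp: in_L2_def)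
  also have "\<dots> = 3 * (\<integral>x. (f x - c k (f x))\<^sup>2 \<partial>?M) + 3 * (\<integral>x. (c k (f x) - u n x)\<^sup>2 \<partial>?M) +
      3 * (\<integral>x. (u n x - \<phi> x)\<^sup>2 \<partial>?M)"
    using i by (simp add: in_L2_def)
  also have "\<dots> < \<epsilon>"
    using k n s by simp
  finally show ?thesis
    using \<phi>(1) by blast
qed

section \<open>Testing against translates\<close>

lemma in_L2_nn_integral:
  fixes f :: "real \<times> real \<Rightarrow> real"
  assumes "in_L2 f"
  shows "(\<integral>\<^sup>+x\<in>torus. ennreal ((f x)\<^sup>2) \<partial>lborel) = ennreal (\<integral>x. (f x)\<^sup>2 \<partial>torus_measure)"
  using assms nn_integral_eq_integral[of torus_measure "\<lambda>x. (f x)\<^sup>2"]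
  by (simp add: in_L2_def nn_integral_torus_measure)

section \<open>Young's inequality and the components of the gradient\<close>

lemma young_real:
  fixes x y \<alpha> :: real
  assumes "0 < \<alpha>"
  shows "\<bar>x * y\<bar> \<le> \<alpha> / 2 * x\<^sup>2 + 1 / (2 * \<alpha>) * y\<^sup>2"
proof -
  have "0 \<le> (\<alpha> * \<bar>x\<bar> - \<bar>y\<bar>)\<^sup>2"
    by simp
  then have "2 * \<alpha> * \<bar>x * y\<bar> \<le> \<alpha>\<^sup>2 * x\<^sup>2 + y\<^sup>2"
    by (simp add: power2_diff power_mult_distrib abs_mult mult_ac)
  then show ?thesis
    using assms by (simp add: field_simps power2_eq_square)
qed

lemma integral_young:
  fixes u v :: "real \<times> real \<Rightarrow> real"
  assumes "in_L2 u" "in_L2 v" "0 < \<alpha>"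
  shows "\<bar>\<integral>x. u x * v x \<partial>torus_measure\<bar> \<le>
    \<alpha> / 2 * (\<integral>x. (u x)\<^sup>2 \<partial>torus_measure) + 1 / (2 * \<alpha>) * (\<integral>x. (v x)\<^sup>2 \<partial>torus_measure)"
proof -
  have i: "integrable torus_measure (\<lambda>x. (u x)\<^sup>2)" "integrable torus_measure (\<lambda>x. (v x)\<^sup>2)"
    using assms by (auto simp: in_L2_def)
  have "\<bar>\<integral>x. u x * v x \<partial>torus_measure\<bar> \<le> (\<integral>x. \<bar>u x * v x\<bar> \<partial>torus_measure)"
    by (rule integral_abs_bound)
  also have "\<dots> \<le> (\<integral>x. \<alpha> / 2 * (u x)\<^sup>2 + 1 / (2 * \<alpha>) * (v x)\<^sup>2 \<partial>torus_measure)"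
    using in_L2_mult_integrable[OF assms(1,2)] i young_real[OF assms(3)]
    by (intro integral_mono integrable_abs Bochner_Integration.integrable_add integrable_mult_right)
  also have "\<dots> = \<alpha> / 2 * (\<integral>x. (u x)\<^sup>2 \<partial>torus_measure) + 1 / (2 * \<alpha>) * (\<integral>x. (v x)\<^sup>2 \<partial>torus_measure)"
    using i by (subst Bochner_Integration.integral_add) auto
  finally show ?thesis .
qed

lemma in_L2_inner:
  fixes g :: "real \<times> real \<Rightarrow> real \<times> real"
  assumes "in_L2 g" "e \<in> Basis"
  shows "in_L2 (\<lambda>x. g x \<bullet> e)"
proof -
  have m: "g \<in> borel_measurable torus_measure"
    using assms(1) by (simp add: in_L2_def)
  have "integrable torus_measure (\<lambda>x. (g x \<bullet> e)\<^sup>2)"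
  proof (rule Bochner_Integration.integrable_bound)
    show "integrable torus_measure (\<lambda>x. (norm (g x))\<^sup>2)"
      using assms(1) by (simp add: in_L2_def)
    show "(\<lambda>x. (g x \<bullet> e)\<^sup>2) \<in> borel_measurable torus_measure"
      using m by measurable
    have "(g x \<bullet> e)\<^sup>2 \<le> (norm (g x))\<^sup>2" for x
      using power_mono[OF Basis_le_norm[OF assms(2), of "g x"], of 2] by simp
    then show "AE x in torus_measure. norm ((g x \<bullet> e)\<^sup>2) \<le> norm ((norm (g x))\<^sup>2)"
      by simp
  qed
  then show ?thesis
    using m by (simp add: in_L2_def)
qed

text \<open>The difference is the derivative along \<open>e\<close> of the segment integral
  \<open>\<Psi>\<close>, so the weak gradient turns the left-hand side into an integral of
  \<open>g x \<bullet> e\<close> against \<open>\<Psi>\<close>. Young's inequality and the norm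
  bound with factor \<open>4 * a\<^sup>2\<close> conclude.\<close>

lemma weak_gradient_translate_bound:
  assumes f: "in_L2 f" and g: "in_L2 g" "has_weak_gradient f g"
    and \<phi>: "\<phi> \<in> trig" and e: "e \<in> Basis" and a: "0 \<le> a" "a \<le> 2 * pi" and \<alpha>: "0 < \<alpha>"
  shows "\<bar>\<integral>x. f x * (\<phi> (x + a *\<^sub>R e) - \<phi> x) \<partial>torus_measure\<bar> \<le>
    \<alpha> / 2 * (\<integral>x. (g x \<bullet> e)\<^sup>2 \<partial>torus_measure) + 2 * a\<^sup>2 / \<alpha> * (\<integral>x. (\<phi> x)\<^sup>2 \<partial>torus_measure)"
proof -
  obtain \<Psi> where \<Psi>: "\<Psi> \<in> trig"
    and int: "\<And>x. ((\<lambda>t. \<phi> (x + t *\<^sub>R e)) has_integral \<Psi> x) {0..a}"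
    and d: "\<And>x. \<exists>D. (\<Psi> has_derivative D) (at x) \<and> D e = \<phi> (x + a *\<^sub>R e) - \<phi> x"
    using trig_segment_integral[OF \<phi> a(1) e] by blast
  have pd: "partial_deriv e \<Psi> x = \<phi> (x + a *\<^sub>R e) - \<phi> x" for x
    using d[of x] partial_deriv_eq by metis
  have "(\<integral>x. f x * partial_deriv e \<Psi> x \<partial>torus_measure) = - (\<integral>x. (g x \<bullet> e) * \<Psi> x \<partial>torus_measure)"
    using g(2) trig_test_function[OF \<Psi>] e unfolding has_weak_gradient_def by blast
  then have "(\<integral>x. f x * (\<phi> (x + a *\<^sub>R e) - \<phi> x) \<partial>torus_measure) = - (\<integral>x. (g x \<bullet> e) * \<Psi> x \<partial>torus_measure)"
    unfolding pd .
  then have "\<bar>\<integral>x. f x * (\<phi> (x + a *\<^sub>R e) - \<phi> x) \<partial>torus_measure\<bar> \<le>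
      \<alpha> / 2 * (\<integral>x. (g x \<bullet> e)\<^sup>2 \<partial>torus_measure) + 1 / (2 * \<alpha>) * (\<integral>x. (\<Psi> x)\<^sup>2 \<partial>torus_measure)"
    using integral_young[OF in_L2_inner[OF g(1) e] trig_in_L2[OF \<Psi>] \<alpha>] by simp
  moreover have "(\<integral>x. (\<Psi> x)\<^sup>2 \<partial>torus_measure) \<le> 4 * a\<^sup>2 * (\<integral>x. (\<phi> x)\<^sup>2 \<partial>torus_measure)"
    using trig_segment_integral_norm_le[OF \<phi> a e \<Psi> int]
    by (simp add: in_L2_nn_integral trig_in_L2 \<phi> \<Psi> ennreal_le_iff flip: ennreal_mult)
  then have "1 / (2 * \<alpha>) * (\<integral>x. (\<Psi> x)\<^sup>2 \<partial>torus_measure) \<le>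
      1 / (2 * \<alpha>) * (4 * a\<^sup>2 * (\<integral>x. (\<phi> x)\<^sup>2 \<partial>torus_measure))"
    using \<alpha> by (intro mult_left_mono) auto
  moreover have "1 / (2 * \<alpha>) * (4 * a\<^sup>2 * c) = 2 * a\<^sup>2 / \<alpha> * c" for c
    using \<alpha> by (simp add: field_simps)
  ultimately show ?thesis
    by simp
qed

lemma trig_translate_norm_le:
  assumes "\<phi> \<in> trig" "fst v \<in> {0..2 * pi}" "snd v \<in> {0..2 * pi}"
  shows "(\<integral>x. (\<phi> (x + v))\<^sup>2 \<partial>torus_measure) \<le> 4 * (\<integral>x. (\<phi> x)\<^sup>2 \<partial>torus_measure)"
proof -
  have "ennreal (\<integral>x. (\<phi> (x + v))\<^sup>2 \<partial>torus_measure) \<le> ennreal (4 * (\<integral>x. (\<phi> x)\<^sup>2 \<partial>torus_measure))"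
    using nn_integral_trig_translate_le[OF assms]
    by (simp add: in_L2_nn_integral[OF trig_in_L2] trig_translate assms(1) ennreal_mult)
  then show ?thesis
    by (subst (asm) ennreal_le_iff) (auto intro!: integral_nonneg_AE)
qed

text \<open>The shift by \<open>v\<close> is made one coordinate at a time, through
  \<open>\<phi>1\<close> to \<open>\<phi>2\<close>, each step being paid for by one component of the
  gradient. Only the last term on the right depends on \<open>v\<close>, which prepares for
  averaging over \<open>v\<close>.\<close>

lemma integral_trig_le:
  assumes f: "in_L2 f" and g: "in_L2 g" "has_weak_gradient f g" and \<phi>: "\<phi> \<in> trig"
    and s: "0 < s" "s \<le> 2 * pi" and v: "v \<in> {0..s} \<times> {0..s}" and \<beta>: "0 < \<beta>"
  shows "(\<integral>x. f x * \<phi> x \<partial>torus_measure) \<le>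
    40 * s\<^sup>2 * (\<integral>x. (norm (g x))\<^sup>2 \<partial>torus_measure) + (\<integral>x. (\<phi> x)\<^sup>2 \<partial>torus_measure) / 8 +
    \<beta> / 2 * (\<integral>x. \<bar>f x\<bar> \<partial>torus_measure) +
    1 / (2 * \<beta>) * (\<integral>x. \<bar>f x\<bar> * (\<phi> (x + v))\<^sup>2 \<partial>torus_measure)"
proof -
  let ?I = "\<lambda>h. \<integral>x. h x \<partial>torus_measure"
  obtain a b where ab: "v = (a, b)" "0 \<le> a" "a \<le> s" "0 \<le> b" "b \<le> s"
    using v by auto
  define \<phi>1 where "\<phi>1 x = \<phi> (x + a *\<^sub>R (1, 0))" for x
  define \<phi>2 where "\<phi>2 x = \<phi>1 (x + b *\<^sub>R (0, 1))" for x
  have \<phi>1: "\<phi>1 \<in> trig"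
    using trig_translate[OF \<phi>] unfolding \<phi>1_def by blast
  then have \<phi>2: "\<phi>2 \<in> trig"
    using trig_translate unfolding \<phi>2_def by blast
  have \<phi>2_eq: "\<phi>2 x = \<phi> (x + v)" for x
    by (simp add: \<phi>2_def \<phi>1_def ab(1) add.assoc)
  have basis: "(1, 0) \<in> (Basis :: (real \<times> real) set)" "(0, 1) \<in> (Basis :: (real \<times> real) set)"
    by (auto simp: Basis_prod_def)
  define N where "N = ?I (\<lambda>x. (\<phi> x)\<^sup>2)"
  define G1 where "G1 = ?I (\<lambda>x. (g x \<bullet> (1, 0))\<^sup>2)"
  define G2 where "G2 = ?I (\<lambda>x. (g x \<bullet> (0, 1))\<^sup>2)"
  have "N \<ge> 0"
    unfolding N_def by (intro integral_nonneg_AE) simp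
  \<comment> \<open>The Young parameter \<open>80 * s\<^sup>2\<close> leaves \<open>N / 40\<close>
    from the first shift and, as the norm of \<open>\<phi>1\<close> is controlled up to the factor
    4, \<open>N / 10\<close> from the second. Their sum is \<open>N / 8\<close>.\<close>
  have s2: "0 < 80 * s\<^sup>2"
    using s by simp
  have a2: "2 * a\<^sup>2 / (80 * s\<^sup>2) \<le> 1 / 40" if "0 \<le> a" "a \<le> s" for a
    using power_mono[OF that(2,1), of 2] s by (simp add: field_simps)
  have "?I (\<lambda>x. (g x \<bullet> (1, 0))\<^sup>2 + (g x \<bullet> (0, 1))\<^sup>2) = G1 + G2"
    unfolding G1_def G2_def using in_L2_inner[OF g(1)] basis
    by (intro Bochner_Integration.integral_add) (auto simp: in_L2_def)
  moreover have "(g x \<bullet> (1, 0))\<^sup>2 + (g x \<bullet> (0, 1))\<^sup>2 = (norm (g x))\<^sup>2" for x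
    by (cases "g x") (simp add: norm_Pair)
  ultimately have G: "?I (\<lambda>x. (norm (g x))\<^sup>2) = G1 + G2"
    by simp
  have "\<bar>?I (\<lambda>x. f x * (\<phi>1 x - \<phi> x))\<bar> \<le> 80 * s\<^sup>2 / 2 * G1 + 2 * a\<^sup>2 / (80 * s\<^sup>2) * N"
    unfolding \<phi>1_def G1_def N_def
    using weak_gradient_translate_bound[OF f g \<phi> basis(1) _ _ s2, of a] ab s by simp
  moreover have "2 * a\<^sup>2 / (80 * s\<^sup>2) * N \<le> 1 / 40 * N"
    using a2 ab \<open>N \<ge> 0\<close> by (intro mult_right_mono)
  ultimately have 1: "\<bar>?I (\<lambda>x. f x * (\<phi>1 x - \<phi> x))\<bar> \<le> 40 * s\<^sup>2 * G1 + N / 40"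
    by linarith
  have "\<bar>?I (\<lambda>x. f x * (\<phi>2 x - \<phi>1 x))\<bar> \<le> 80 * s\<^sup>2 / 2 * G2 + 2 * b\<^sup>2 / (80 * s\<^sup>2) * ?I (\<lambda>x. (\<phi>1 x)\<^sup>2)"
    unfolding \<phi>2_def G2_def
    using weak_gradient_translate_bound[OF f g \<phi>1 basis(2) _ _ s2, of b] ab s by simp
  moreover have "2 * b\<^sup>2 / (80 * s\<^sup>2) * ?I (\<lambda>x. (\<phi>1 x)\<^sup>2) \<le> 1 / 40 * (4 * N)"
    unfolding \<phi>1_def N_def using a2 ab s
    by (intro mult_mono trig_translate_norm_le[OF \<phi>] integral_nonneg_AE) auto
  ultimately have 2: "\<bar>?I (\<lambda>x. f x * (\<phi>2 x - \<phi>1 x))\<bar> \<le> 40 * s\<^sup>2 * G2 + N / 10"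
    by linarith
  have if2: "integrable torus_measure (\<lambda>x. \<bar>f x\<bar> * (\<phi>2 x)\<^sup>2)"
    using integrable_abs[OF in_L2_mult_integrable[OF f trig_in_L2[OF trig_mult[OF \<phi>2 \<phi>2]]]]
    by (simp add: abs_mult power2_eq_square)
  have if1: "integrable torus_measure (\<lambda>x. \<bar>f x\<bar>)"
    using in_L2_mult_integrable[OF f trig_in_L2[OF trig_const[of 1]]] by simp
  have "?I (\<lambda>x. f x * \<phi>2 x) \<le> ?I (\<lambda>x. \<beta> / 2 * \<bar>f x\<bar> + 1 / (2 * \<beta>) * (\<bar>f x\<bar> * (\<phi>2 x)\<^sup>2))"
  proof (intro integral_mono)
    fix x
    \<comment> \<open>Young's inequality is applied to \<open>1 * \<phi>2 x\<close> with weight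
      \<open>\<bar>f x\<bar>\<close>, so that the first resulting term is the \<open>L1\<close> norm
      of \<open>f\<close>.\<close>
    have "f x * \<phi>2 x \<le> \<bar>f x\<bar> * \<bar>1 * \<phi>2 x\<bar>"
      by (simp flip: abs_mult)
    also have "\<dots> \<le> \<bar>f x\<bar> * (\<beta> / 2 * 1\<^sup>2 + 1 / (2 * \<beta>) * (\<phi>2 x)\<^sup>2)"
      by (intro mult_left_mono young_real \<beta>) simp
    finally show "f x * \<phi>2 x \<le> \<beta> / 2 * \<bar>f x\<bar> + 1 / (2 * \<beta>) * (\<bar>f x\<bar> * (\<phi>2 x)\<^sup>2)"
      by (simp add: algebra_simps)
  qed (intro Bochner_Integration.integrable_add integrable_mult_right if1 if2
      in_L2_mult_integrable f trig_in_L2 \<phi>2)+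
  also have "\<dots> = \<beta> / 2 * ?I (\<lambda>x. \<bar>f x\<bar>) + 1 / (2 * \<beta>) * ?I (\<lambda>x. \<bar>f x\<bar> * (\<phi>2 x)\<^sup>2)"
    using if1 if2 by (subst Bochner_Integration.integral_add) auto
  finally have 3: "?I (\<lambda>x. f x * \<phi>2 x) \<le>
      \<beta> / 2 * ?I (\<lambda>x. \<bar>f x\<bar>) + 1 / (2 * \<beta>) * ?I (\<lambda>x. \<bar>f x\<bar> * (\<phi>2 x)\<^sup>2)" .
  have i: "integrable torus_measure (\<lambda>x. f x * \<phi> x)" "integrable torus_measure (\<lambda>x. f x * \<phi>1 x)"
    "integrable torus_measure (\<lambda>x. f x * \<phi>2 x)"
    using in_L2_mult_integrable f trig_in_L2 \<phi> \<phi>1 \<phi>2 by blast+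
  have "?I (\<lambda>x. f x * (\<phi>1 x - \<phi> x)) = ?I (\<lambda>x. f x * \<phi>1 x) - ?I (\<lambda>x. f x * \<phi> x)"
    "?I (\<lambda>x. f x * (\<phi>2 x - \<phi>1 x)) = ?I (\<lambda>x. f x * \<phi>2 x) - ?I (\<lambda>x. f x * \<phi>1 x)"
    unfolding right_diff_distrib using i by (auto intro: Bochner_Integration.integral_diff)
  with 1 2 3 have "?I (\<lambda>x. f x * \<phi> x) \<le> 40 * s\<^sup>2 * G1 + N / 40 + (40 * s\<^sup>2 * G2 + N / 10) +
      (\<beta> / 2 * ?I (\<lambda>x. \<bar>f x\<bar>) + 1 / (2 * \<beta>) * ?I (\<lambda>x. \<bar>f x\<bar> * (\<phi>2 x)\<^sup>2))"
    by linarith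
  then show ?thesis
    unfolding G N_def[symmetric] \<phi>2_eq by (simp add: algebra_simps)
qed

section \<open>A superquadratic minorant\<close>

text \<open>Beyond thresholds \<open>R n\<close> the second component dominates
  \<open>(real n + 2) * X\<^sup>2\<close>. Adding a new truncated parabola at each threshold gives a
  locally finite convex \<open>C1\<close> sum that outgrows every multiple of the square, yet slowly
  enough to stay below. The linear term makes it strictly increasing before the first
  threshold.\<close>

lemma superquadratic_minorant:
  fixes P :: "real \<Rightarrow> real \<Rightarrow> bool"
  assumes nonneg: "\<And>X G. P X G \<Longrightarrow> 0 \<le> X \<and> 0 \<le> G"
    and superquad: "\<And>C. \<exists>R. \<forall>X G. P X G \<longrightarrow> R \<le> X \<longrightarrow> C * X\<^sup>2 \<le> G"
  shows "\<exists>\<Upsilon>. C1_on_nonneg \<Upsilon> \<and> convex_on {0..} \<Upsilon> \<and> strict_mono_on {0..} \<Upsilon> \<and> superquadratic \<Upsilon> \<and>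
    (\<forall>X G. P X G \<longrightarrow> \<Upsilon> X \<le> G)"
proof -
  obtain \<rho> where \<rho>: "\<And>C X G. P X G \<Longrightarrow> \<rho> C \<le> X \<Longrightarrow> C * X\<^sup>2 \<le> G"
    using superquad by metis
  \<comment> \<open>Summing the absolute values makes the thresholds monotone and at least each
    earlier \<open>\<rho>\<close>.\<close>
  define R where "R n = real n + 1 + (\<Sum>k\<le>n. \<bar>\<rho> (real k + 2)\<bar>)" for n
  have R_mono: "R m \<le> R n" if "m \<le> n" for m n
    using that unfolding R_def by (intro add_mono sum_mono2) auto
  have R_ge: "real n + 1 \<le> R n" for n
    by (simp add: R_def sum_nonneg)
  have R: "(real n + 2) * X\<^sup>2 \<le> G" if "P X G" "R n \<le> X" for n X G
  proof (rule \<rho>[OF that(1)])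
    have "\<bar>\<rho> (real n + 2)\<bar> \<le> (\<Sum>k\<le>n. \<bar>\<rho> (real k + 2)\<bar>)"
      by (rule member_le_sum) auto
    then show "\<rho> (real n + 2) \<le> X"
      using that(2) by (simp add: R_def)
  qed
  \<comment> \<open>As \<open>R n > n\<close>, the upper limit \<open>nat \<lceil>x\<rceil>\<close> cuts off only vanishing terms. If \<open>N\<close> is the last
    index with \<open>R N < x\<close>, then \<open>\<Upsilon> x \<le> x + (N + 1) x\<^sup>2 \<le> (N + 2) x\<^sup>2\<close>.\<close>
  define q where "q n x = (max 0 (x - R n))\<^sup>2" for n x
  define \<Upsilon> where "\<Upsilon> x = x - R 0 + (\<Sum>n<nat \<lceil>x\<rceil>. q n x)" for x
  define \<Upsilon>' where "\<Upsilon>' x = 1 + (\<Sum>n<nat \<lceil>x\<rceil>. 2 * max 0 (x - R n))" for x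
  \<comment> \<open>Any upper limit \<open>m\<close> with \<open>x \<le> real m\<close> gives the
    same sum, so near a point \<open>m\<close> can be held fixed.\<close>
  have extend: "(\<Sum>n<nat \<lceil>x\<rceil>. h (max 0 (x - R n))) = (\<Sum>n<m. h (max 0 (x - R n)))"
    if "h 0 = (0::real)" "x \<le> real m" for h x m
  proof (rule sum.mono_neutral_left)
    show "{..<nat \<lceil>x\<rceil>} \<subseteq> {..<m}"
      using that(2) by (auto simp: nat_less_iff zless_nat_eq_int_zless less_ceiling_iff)
    have "max 0 (x - R n) = 0" if "\<not> n < nat \<lceil>x\<rceil>" for n
    proof -
      have "x \<le> real n"
        using that by linarith
      then show ?thesis
        using R_ge[of n] by simp
    qed
    then show "\<forall>n\<in>{..<m} - {..<nat \<lceil>x\<rceil>}. h (max 0 (x - R n)) = 0"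
      using that(1) by (metis DiffD2 lessThan_iff)
  qed simp
  have \<Upsilon>_eq: "\<Upsilon> x = x - R 0 + (\<Sum>n<m. q n x)" if "x \<le> real m" for x m
    using extend[of "\<lambda>y. y\<^sup>2" x m] that by (simp add: \<Upsilon>_def q_def)
  have \<Upsilon>'_eq: "\<Upsilon>' x = 1 + (\<Sum>n<m. 2 * max 0 (x - R n))" if "x \<le> real m" for x m
    using extend[of "\<lambda>y. 2 * y" x m] that by (simp add: \<Upsilon>'_def)
  have q_deriv: "(q n has_real_derivative 2 * max 0 (x - R n)) (at x)" for n x
  proof -
    consider "x < R n" | "x > R n" | "x = R n" by linarith
    then show ?thesis
    proof cases
      case 1
      have "((\<lambda>x. 0) has_real_derivative 0) (at x)" by simp
      then have "(q n has_real_derivative 0) (at x)"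
        by (rule has_field_derivative_transform_within_open[of _ _ _ "{..<R n}"])
          (use 1 in \<open>auto simp: q_def\<close>)
      with 1 show ?thesis by simp
    next
      case 2
      have "((\<lambda>x. (x - R n)\<^sup>2) has_real_derivative 2 * (x - R n)) (at x)"
        by (auto intro!: derivative_eq_intros)
      then have "(q n has_real_derivative 2 * (x - R n)) (at x)"
        by (rule has_field_derivative_transform_within_open[of _ _ _ "{R n<..}"])
          (use 2 in \<open>auto simp: q_def\<close>)
      with 2 show ?thesis by simp
    next
      case 3
      \<comment> \<open>At the joint of the two branches \<open>q n\<close> vanishes and grows at
        most like the square of \<open>h\<close>.\<close>
      have "((\<lambda>h. (q n (x + h) - q n x) / h) \<longlongrightarrow> 0) (at 0)"
      proof (rule Lim_null_comparison)
        show "\<forall>\<^sub>F h in at 0. norm ((q n (x + h) - q n x) / h) \<le> \<bar>h\<bar>"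
          using 3 by (intro always_eventually) (auto simp: q_def max_def power2_eq_square)
        show "((\<lambda>h. \<bar>h\<bar>) \<longlongrightarrow> 0) (at (0::real))"
          by (intro tendsto_eq_intros) auto
      qed
      with 3 show ?thesis by (simp add: DERIV_def)
    qed
  qed
  have \<Upsilon>_deriv: "(\<Upsilon> has_real_derivative \<Upsilon>' x) (at x)" for x
  proof -
    \<comment> \<open>The added 1 makes \<open>x < real m\<close> strict, so the formula with fixed
      \<open>m\<close> holds on an open neighbourhood of \<open>x\<close>.\<close>
    define m where "m = nat \<lceil>x\<rceil> + 1"
    have m: "x < real m"
      unfolding m_def by linarith
    have "((\<lambda>x. x - R 0 + (\<Sum>n<m. q n x)) has_real_derivative 1 + (\<Sum>n<m. 2 * max 0 (x - R n))) (at x)"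
      by (auto intro!: derivative_eq_intros q_deriv)
    then have "(\<Upsilon> has_real_derivative 1 + (\<Sum>n<m. 2 * max 0 (x - R n))) (at x)"
      by (rule has_field_derivative_transform_within_open[of _ _ _ "{..<real m}"])
        (use m in \<open>auto simp: \<Upsilon>_eq[of _ m]\<close>)
    then show ?thesis
      using m by (simp add: \<Upsilon>'_eq[of x m])
  qed
  have \<Upsilon>'_mono: "\<Upsilon>' x \<le> \<Upsilon>' y" if "x \<le> y" for x y
  proof -
    have "y \<le> real (nat \<lceil>y\<rceil>)" by linarith
    then show ?thesis
      using that by (simp add: \<Upsilon>'_eq[of _ "nat \<lceil>y\<rceil>"]) (intro sum_mono; simp)
  qed
  have \<Upsilon>'_pos: "0 < \<Upsilon>' x" for x
    unfolding \<Upsilon>'_def by (intro add_pos_nonneg sum_nonneg) auto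
  have \<Upsilon>'_cont: "continuous_on A \<Upsilon>'" for A
  proof (rule continuous_at_imp_continuous_on, rule ballI)
    fix x :: real
    define m where "m = nat \<lceil>x\<rceil> + 1"
    have "x \<in> {..<real m}"
      unfolding m_def by simp linarith
    moreover have "continuous_on {..<real m} (\<lambda>x. 1 + (\<Sum>n<m. 2 * max 0 (x - R n)))"
      by (intro continuous_intros)
    then have "continuous_on {..<real m} \<Upsilon>'"
      by (rule continuous_on_eq) (simp add: \<Upsilon>'_eq[of _ m])
    ultimately show "isCont \<Upsilon>' x"
      using continuous_on_eq_continuous_at open_lessThan by blast
  qed
  have "C1_on_nonneg \<Upsilon>"
    unfolding C1_on_nonneg_def
    by (intro exI[of _ \<Upsilon>'] conjI ballI has_field_derivative_at_within[OF \<Upsilon>_deriv] \<Upsilon>'_cont)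
  moreover have "convex_on {0..} \<Upsilon>"
    by (rule convex_on_realI[of _ _ \<Upsilon>']) (use \<Upsilon>_deriv \<Upsilon>'_mono in \<open>simp_all add: connected_iff_interval\<close>)
  moreover have "strict_mono_on {0..} \<Upsilon>"
  proof (rule strict_mono_onI)
    fix x y :: real assume "x < y"
    then show "\<Upsilon> x < \<Upsilon> y"
      by (rule DERIV_pos_imp_increasing) (rule exI, rule conjI, rule \<Upsilon>_deriv, rule \<Upsilon>'_pos)
  qed
  moreover have "superquadratic \<Upsilon>"
    unfolding superquadratic_def filterlim_at_top
  proof
    fix Z :: real
    \<comment> \<open>Once \<open>x\<close> exceeds \<open>2 * R m\<close>, each of the first
      \<open>m\<close> parabolas contributes at least a quarter of \<open>x\<^sup>2\<close>; hence
      about \<open>4 * Z\<close> of them suffice.\<close>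
    define m where "m = nat \<lceil>4 * Z\<rceil>"
    have mZ: "4 * Z \<le> real m" unfolding m_def by linarith
    show "\<forall>\<^sub>F x in at_top. Z \<le> \<Upsilon> x / x\<^sup>2"
      using eventually_ge_at_top[of "2 * R m"]
    proof eventually_elim
      case (elim x)
      have "R 0 \<le> R m" "1 \<le> R 0" "real m + 1 \<le> R m"
        using R_mono[of 0 m] R_ge[of 0] R_ge[of m] by auto
      with elim have x: "0 < x" "R 0 \<le> x" "real m \<le> x"
        by linarith+
      have "x / 2 \<le> max 0 (x - R n)" if "n < m" for n
        using R_mono[of n m] that elim by (auto simp: max_def)
      then have "(x / 2)\<^sup>2 \<le> q n x" if "n < m" for n
        unfolding q_def using that x(1) by (intro power_mono) auto
      then have "(\<Sum>n<m. (x / 2)\<^sup>2) \<le> (\<Sum>n<m. q n x)"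
        by (intro sum_mono) auto
      also have "\<dots> \<le> (\<Sum>n<nat \<lceil>x\<rceil>. q n x)"
        using x(3) by (intro sum_mono2) (auto simp: q_def, linarith)
      also have "\<dots> \<le> \<Upsilon> x"
        using x by (simp add: \<Upsilon>_def)
      finally have "real m * x\<^sup>2 \<le> 4 * \<Upsilon> x"
        by (simp add: power_divide)
      moreover have "4 * Z * x\<^sup>2 \<le> real m * x\<^sup>2"
        by (rule mult_right_mono[OF mZ]) simp
      ultimately have "Z * x\<^sup>2 \<le> \<Upsilon> x"
        by linarith
      then show ?case
        using x(1) by (simp add: le_divide_eq)
    qed
  qed
  moreover have "\<Upsilon> X \<le> G" if "P X G" for X G
  proof -
    let ?m = "nat \<lceil>X\<rceil>"
    let ?A = "{n\<in>{..<?m}. R n < X}"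
    have X: "0 \<le> X" "0 \<le> G" using nonneg[OF that] by auto
    have sum_A: "(\<Sum>n<?m. q n X) = (\<Sum>n\<in>?A. q n X)"
      by (rule sum.mono_neutral_right) (auto simp: q_def)
    show ?thesis
    proof (cases "?A = {}")
      \<comment> \<open>No parabola is active, so \<open>X \<le> R 0\<close>. Subtracting
        \<open>R 0\<close> makes the linear term nonpositive here, and thus at most
        \<open>G\<close>.\<close>
      case True
      have "(\<Sum>n<?m. q n X) = 0"
        unfolding sum_A True by simp
      moreover have "X \<le> R 0"
      proof (rule ccontr)
        assume "\<not> X \<le> R 0"
        with R_ge[of 0] have "0 \<in> ?A" by auto
        with True show False by blast
      qed
      ultimately show ?thesis
        using X by (simp add: \<Upsilon>_def)
    next
      case False
      define N where "N = Max ?A"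
      have N: "N \<in> ?A" unfolding N_def using False by (intro Max_in) auto
      have R0: "1 \<le> R 0" "R 0 \<le> R N" "R N < X" using R_ge[of 0] R_mono[of 0 N] N by auto
      have "n \<le> N" if "n \<in> ?A" for n
        unfolding N_def using that by (intro Max_ge) auto
      then have "card ?A \<le> card {..N}"
        by (intro card_mono) auto
      have "q n X \<le> X\<^sup>2" for n
        unfolding q_def using X R_ge[of n] by (intro power_mono) auto
      then have "(\<Sum>n\<in>?A. q n X) \<le> real (card ?A) * X\<^sup>2"
        using sum_bounded_above[of ?A "\<lambda>n. q n X" "X\<^sup>2"] by simp
      also have "\<dots> \<le> (real N + 1) * X\<^sup>2"
        using \<open>card ?A \<le> card {..N}\<close> by (intro mult_right_mono) auto
      finally have "\<Upsilon> X \<le> X + (real N + 1) * X\<^sup>2"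
        using sum_A R0 by (simp add: \<Upsilon>_def)
      moreover have "X \<le> X\<^sup>2"
        using R0 by (simp add: power2_eq_square)
      ultimately have "\<Upsilon> X \<le> (real N + 2) * X\<^sup>2"
        by (simp add: algebra_simps)
      also have "\<dots> \<le> G"
        using R[OF that] R0 by simp
      finally show ?thesis .
    qed
  qed
  ultimately show ?thesis
    by blast
qed

section \<open>The gradient estimate\<close>

lemma torus_dist_le:
  "torus_dist x y \<le> norm (x - y + (2 * pi * of_int k, 2 * pi * of_int l))"
proof -
  have "torus_dist x y \<le> (case (k, l) of (k, l) \<Rightarrow> norm (x - y + (2 * pi * of_int k, 2 * pi * of_int l)))"
    unfolding torus_dist_def by (rule cINF_lower) (auto intro!: bdd_belowI[of _ 0])
  then show ?thesis
    by simp
qed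

lemma torus_representative:
  fixes y :: "real \<times> real"
  shows "\<exists>k l :: int. y - (2 * pi * of_int k, 2 * pi * of_int l) \<in> torus"
proof -
  have "\<exists>k :: int. t - 2 * pi * of_int k \<in> {-pi..pi}" for t :: real
  proof
    define k where "k = \<lfloor>(t + pi) / (2 * pi)\<rfloor>"
    have "of_int k \<le> (t + pi) / (2 * pi)" "(t + pi) / (2 * pi) < of_int k + 1"
      unfolding k_def by linarith+
    then show "t - 2 * pi * of_int k \<in> {-pi..pi}"
      by (simp add: field_simps)
  qed
  then obtain k l :: int where "fst y - 2 * pi * of_int k \<in> {-pi..pi}" "snd y - 2 * pi * of_int l \<in> {-pi..pi}"
    by meson
  then show ?thesis
    by (intro exI[of _ k] exI[of _ l]) (simp add: torus_def mem_Times_iff)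
qed

lemma emeasure_lborel_square:
  "0 \<le> s \<Longrightarrow> emeasure lborel ({0..s} \<times> {0..s} :: (real \<times> real) set) = ennreal (s\<^sup>2)"
  unfolding lborel_prod[symmetric]
  by (subst lborel.emeasure_pair_measure_Times) (auto simp: ennreal_mult power2_eq_square)

text \<open>With \<open>y = x + v\<close> and Fubini, the inner integral for fixed \<open>y\<close>
  is the mass of \<open>\<bar>f\<bar>\<close> on a square of side \<open>s\<close> near
  \<open>y\<close>, at most \<open>\<eta>\<close> by concentration. What remains is the square of
  \<open>\<phi>\<close> over the possible \<open>y\<close>, all in
  \<open>big_square\<close>.\<close>

lemma average_translates_le:
  assumes f: "in_L2 f" and \<phi>: "\<phi> \<in> trig" and s: "0 < s" "s \<le> 2 * pi" "2 * s < r"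
    and conc: "\<And>z. z \<in> torus \<Longrightarrow> (\<integral>\<^sup>+y\<in>{y. torus_dist z y < r}. ennreal \<bar>f y\<bar> \<partial>torus_measure) \<le> \<eta>"
  shows "(\<integral>\<^sup>+v\<in>{0..s} \<times> {0..s}. (\<integral>\<^sup>+x. ennreal (\<bar>f x\<bar> * (\<phi> (x + v))\<^sup>2) \<partial>torus_measure) \<partial>lborel) \<le>
    \<eta> * (4 * (\<integral>\<^sup>+x\<in>torus. ennreal ((\<phi> x)\<^sup>2) \<partial>lborel))"
proof -
  note [measurable] = trig_borel[OF \<phi>]
  define Q where "Q = {0..s} \<times> {0..s}"
  have "Q = cbox (0, 0) (s, s)"
    by (simp add: Q_def cbox_Pair_eq)
  then have [measurable]: "Q \<in> sets borel"
    by simp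
  \<comment> \<open>\<open>f\<close> is only Lebesgue measurable, whereas Fubini for
    \<open>lborel\<close> needs a Borel integrand; \<open>F\<close> is a Borel version of
    \<open>f\<close>.\<close>
  have "(\<lambda>x. if x \<in> torus then f x else 0) \<in> borel_measurable lebesgue"
    using f by (subst borel_measurable_if) (auto simp: in_L2_def)
  from completion_ex_borel_measurable_real[OF this]
  obtain F where [measurable]: "F \<in> borel_measurable borel"
    and F: "AE x in lborel. (if x \<in> torus then f x else 0) = F x"
    by auto
  have fF: "(\<integral>\<^sup>+x. ennreal \<bar>f x\<bar> * h x * indicator torus x \<partial>lborel) =
      (\<integral>\<^sup>+x. ennreal \<bar>F x\<bar> * h x * indicator torus x \<partial>lborel)" for h
    by (rule nn_integral_cong_AE) (use F in \<open>auto simp: indicator_def elim!: eventually_mono\<close>)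
  have inner: "(\<integral>\<^sup>+x. ennreal \<bar>F x\<bar> * indicator Q (y - x) * indicator torus x \<partial>lborel) \<le>
      \<eta> * indicator big_square y" for y
  proof (cases "y \<in> big_square")
    case True
    \<comment> \<open>The concentration bound concerns centres in the torus, so \<open>y\<close> is
      replaced by a representative; \<open>torus_dist\<close> absorbs the period shift.\<close>
    obtain k l where z: "y - (2 * pi * of_int k, 2 * pi * of_int l) \<in> torus" (is "?z \<in> torus")
      using torus_representative by blast
    have near: "torus_dist ?z x < r" if "y - x \<in> Q" for x
    proof -
      have "torus_dist ?z x \<le> norm (y - x)"
        using torus_dist_le[of ?z x k l] by (simp add: algebra_simps)
      also have "\<dots> \<le> norm (fst (y - x)) + norm (snd (y - x))"
        by (metis norm_Pair_le prod.collapse)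
      also have "\<dots> \<le> 2 * s"
        using that by (auto simp: Q_def mem_Times_iff)
      finally show ?thesis
        using s by simp
    qed
    have "(\<integral>\<^sup>+x. ennreal \<bar>F x\<bar> * indicator Q (y - x) * indicator torus x \<partial>lborel) \<le>
        (\<integral>\<^sup>+x\<in>torus. (ennreal \<bar>f x\<bar> * indicator {x. torus_dist ?z x < r} x) \<partial>lborel)"
      unfolding fF[symmetric] using near
      by (intro nn_integral_mono mult_right_mono mult_left_mono) (auto simp: indicator_def)
    also have "\<dots> \<le> \<eta>"
      using conc[OF z] by (simp add: nn_integral_torus_measure)
    finally show ?thesis
      using True by simp
  next
    case False
    have "indicator Q (y - x) * indicator torus x = (0 :: ennreal)" for x
      using False s by (auto simp: Q_def torus_def big_square_def indicator_def mem_Times_iff)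
    then show ?thesis
      unfolding mult.assoc by (simp only: mult_zero_right nn_integral_const mult_zero_left zero_le)
  qed
  have "(\<integral>\<^sup>+v\<in>Q. (\<integral>\<^sup>+x. ennreal (\<bar>f x\<bar> * (\<phi> (x + v))\<^sup>2) \<partial>torus_measure) \<partial>lborel) =
      (\<integral>\<^sup>+v. \<integral>\<^sup>+x. ennreal \<bar>F x\<bar> * ennreal ((\<phi> (v + x))\<^sup>2) * indicator torus x * indicator Q v \<partial>lborel \<partial>lborel)"
    by (simp add: nn_integral_torus_measure ennreal_mult fF nn_integral_multc add.commute)
  also have "\<dots> = (\<integral>\<^sup>+x. \<integral>\<^sup>+v. ennreal \<bar>F x\<bar> * ennreal ((\<phi> (v + x))\<^sup>2) * indicator torus x * indicator Q v \<partial>lborel \<partial>lborel)"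
    by (rule lborel_pair.Fubini') measurable
  also have "\<dots> = (\<integral>\<^sup>+x. \<integral>\<^sup>+y. ennreal \<bar>F x\<bar> * ennreal ((\<phi> y)\<^sup>2) * indicator torus x * indicator Q (y - x) \<partial>lborel \<partial>lborel)"
  proof (rule nn_integral_cong)
    fix x
    show "(\<integral>\<^sup>+v. ennreal \<bar>F x\<bar> * ennreal ((\<phi> (v + x))\<^sup>2) * indicator torus x * indicator Q v \<partial>lborel) =
        (\<integral>\<^sup>+y. ennreal \<bar>F x\<bar> * ennreal ((\<phi> y)\<^sup>2) * indicator torus x * indicator Q (y - x) \<partial>lborel)"
      using nn_integral_lborel_translate
        [of "\<lambda>y. ennreal \<bar>F x\<bar> * ennreal ((\<phi> y)\<^sup>2) * indicator torus x * indicator Q (y - x)" x]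
      by simp
  qed
  also have "\<dots> = (\<integral>\<^sup>+y. \<integral>\<^sup>+x. ennreal \<bar>F x\<bar> * ennreal ((\<phi> y)\<^sup>2) * indicator torus x * indicator Q (y - x) \<partial>lborel \<partial>lborel)"
    by (rule lborel_pair.Fubini') measurable
  also have "\<dots> \<le> (\<integral>\<^sup>+y. \<eta> * (ennreal ((\<phi> y)\<^sup>2) * indicator big_square y) \<partial>lborel)"
  proof (rule nn_integral_mono)
    fix y
    have "(\<integral>\<^sup>+x. ennreal \<bar>F x\<bar> * ennreal ((\<phi> y)\<^sup>2) * indicator torus x * indicator Q (y - x) \<partial>lborel) =
        (\<integral>\<^sup>+x. ennreal ((\<phi> y)\<^sup>2) * (ennreal \<bar>F x\<bar> * indicator Q (y - x) * indicator torus x) \<partial>lborel)"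
      by (simp only: mult_ac)
    also have "\<dots> = ennreal ((\<phi> y)\<^sup>2) *
        (\<integral>\<^sup>+x. ennreal \<bar>F x\<bar> * indicator Q (y - x) * indicator torus x \<partial>lborel)"
      by (rule nn_integral_cmult) measurable
    also have "\<dots> \<le> ennreal ((\<phi> y)\<^sup>2) * (\<eta> * indicator big_square y)"
      by (rule mult_left_mono[OF inner]) simp
    finally show "(\<integral>\<^sup>+x. ennreal \<bar>F x\<bar> * ennreal ((\<phi> y)\<^sup>2) * indicator torus x * indicator Q (y - x) \<partial>lborel) \<le>
        \<eta> * (ennreal ((\<phi> y)\<^sup>2) * indicator big_square y)"
      by (simp only: mult_ac)
  qed
  also have "\<dots> = \<eta> * (\<integral>\<^sup>+y\<in>big_square. ennreal ((\<phi> y)\<^sup>2) \<partial>lborel)"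
    by (rule nn_integral_cmult) measurable
  also have "\<dots> \<le> \<eta> * (4 * (\<integral>\<^sup>+x\<in>torus. ennreal ((\<phi> x)\<^sup>2) \<partial>lborel))"
    by (intro mult_left_mono nn_integral_big_square_le) (auto simp: trig_periodic[OF \<phi>])
  finally show ?thesis
    unfolding Q_def .
qed

lemma L2_norm_le_gradient:
  assumes f: "in_L2 f" and g: "in_L2 g" "has_weak_gradient f g"
    and K: "(\<integral>x. \<bar>f x\<bar> \<partial>torus_measure) \<le> K"
    and s: "0 < s" "s \<le> 2 * pi" "2 * s < r" and \<eta>: "0 < \<eta>"
    and conc: "\<And>z. z \<in> torus \<Longrightarrow> (\<integral>\<^sup>+y\<in>{y. torus_dist z y < r}. ennreal \<bar>f y\<bar> \<partial>torus_measure) \<le> ennreal \<eta>"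
  shows "(\<integral>x. (f x)\<^sup>2 \<partial>torus_measure) \<le> 80 * s\<^sup>2 * (\<integral>x. (norm (g x))\<^sup>2 \<partial>torus_measure) + 16 * \<eta> * K / s\<^sup>2"
proof (rule field_le_epsilon)
  fix \<epsilon> :: real assume "0 < \<epsilon>"
  let ?I = "\<lambda>h. \<integral>x. h x \<partial>torus_measure"
  define G where "G = ?I (\<lambda>x. (norm (g x))\<^sup>2)"
  obtain \<phi> where \<phi>: "\<phi> \<in> trig" and close: "?I (\<lambda>x. (f x - \<phi> x)\<^sup>2) < \<epsilon>"
    using trig_L2_dense[OF f \<open>0 < \<epsilon>\<close>] by blast
  define N where "N = ?I (\<lambda>x. (\<phi> x)\<^sup>2)"
  have "N \<ge> 0"
    unfolding N_def by (intro integral_nonneg_AE) simp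
  \<comment> \<open>Chosen so that averaging over the square of area \<open>s\<^sup>2\<close> yields
    exactly \<open>32 * (A - L) \<le> 4 * N\<close>.\<close>
  define \<beta> where "\<beta> = 16 * \<eta> / s\<^sup>2"
  have \<beta>: "0 < \<beta>" "\<beta> * s\<^sup>2 = 16 * \<eta>"
    using \<eta> s by (auto simp: \<beta>_def)
  define L where "L = 40 * s\<^sup>2 * G + N / 8 + \<beta> / 2 * K"
  define A where "A = ?I (\<lambda>x. f x * \<phi> x)"
  have "A - L \<le> N / 8"
  proof (cases "A \<le> L")
    case True
    then show ?thesis using \<open>N \<ge> 0\<close> by simp
  next
    case False
    \<comment> \<open>The lower bound is the same for all \<open>v\<close>, so it survives
      integration over the square. As \<open>A > L\<close> here, the embedding into
      \<open>ennreal\<close> loses nothing.\<close>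
    have pointwise: "ennreal (2 * \<beta> * (A - L)) \<le> (\<integral>\<^sup>+x. ennreal (\<bar>f x\<bar> * (\<phi> (x + v))\<^sup>2) \<partial>torus_measure)"
      if v: "v \<in> {0..s} \<times> {0..s}" for v
    proof -
      have \<phi>v: "(\<lambda>x. \<phi> (x + v)) \<in> trig"
        by (rule trig_translate[OF \<phi>])
      have int: "integrable torus_measure (\<lambda>x. \<bar>f x\<bar> * (\<phi> (x + v))\<^sup>2)"
        using integrable_abs[OF in_L2_mult_integrable[OF f trig_in_L2[OF trig_mult[OF \<phi>v \<phi>v]]]]
        by (simp add: abs_mult power2_eq_square)
      have "\<beta> / 2 * ?I (\<lambda>x. \<bar>f x\<bar>) \<le> \<beta> / 2 * K"
        using \<beta>(1) K by (intro mult_left_mono) auto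
      then have "A - L \<le> 1 / (2 * \<beta>) * ?I (\<lambda>x. \<bar>f x\<bar> * (\<phi> (x + v))\<^sup>2)"
        using integral_trig_le[OF f g \<phi> s(1,2) v \<beta>(1)] unfolding L_def A_def G_def N_def by linarith
      then have "2 * \<beta> * (A - L) \<le> ?I (\<lambda>x. \<bar>f x\<bar> * (\<phi> (x + v))\<^sup>2)"
        using \<beta>(1) by (simp add: field_simps)
      then have "ennreal (2 * \<beta> * (A - L)) \<le> ennreal (?I (\<lambda>x. \<bar>f x\<bar> * (\<phi> (x + v))\<^sup>2))"
        by (rule ennreal_leI)
      also have "\<dots> = (\<integral>\<^sup>+x. ennreal (\<bar>f x\<bar> * (\<phi> (x + v))\<^sup>2) \<partial>torus_measure)"
        by (rule nn_integral_eq_integral[symmetric, OF int]) simp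
      finally show ?thesis .
    qed
    have "ennreal (2 * \<beta> * (A - L)) * ennreal (s\<^sup>2) =
        (\<integral>\<^sup>+v\<in>{0..s} \<times> {0..s}. ennreal (2 * \<beta> * (A - L)) \<partial>(lborel :: (real \<times> real) measure))"
      using s emeasure_lborel_square[of s]
      by (subst nn_integral_cmult_indicator) (auto simp: borel_Times simp flip: cbox_Pair_eq)
    also have "\<dots> \<le> (\<integral>\<^sup>+v\<in>{0..s} \<times> {0..s}. (\<integral>\<^sup>+x. ennreal (\<bar>f x\<bar> * (\<phi> (x + v))\<^sup>2) \<partial>torus_measure) \<partial>lborel)"
      using pointwise by (intro nn_integral_mono) (auto simp: indicator_def)
    also have "\<dots> \<le> ennreal \<eta> * (4 * ennreal N)"
      using average_translates_le[OF f \<phi> s conc] by (simp add: in_L2_nn_integral[OF trig_in_L2[OF \<phi>]] N_def)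
    also have "\<dots> = ennreal (\<eta> * (4 * N))"
      using \<eta> \<open>N \<ge> 0\<close> by (simp add: ennreal_mult)
    finally have "ennreal (2 * \<beta> * (A - L) * s\<^sup>2) \<le> ennreal (\<eta> * (4 * N))"
      using \<beta>(1) False by (simp add: ennreal_mult)
    then have "2 * \<beta> * (A - L) * s\<^sup>2 \<le> \<eta> * (4 * N)"
      using \<eta> \<open>N \<ge> 0\<close> by (simp add: ennreal_le_iff)
    also have "2 * \<beta> * (A - L) * s\<^sup>2 = 2 * (A - L) * (\<beta> * s\<^sup>2)"
      by (simp only: mult_ac)
    also have "\<dots> = \<eta> * (32 * (A - L))"
      unfolding \<beta>(2) by simp
    finally show ?thesis
      using \<eta> by simp
  qed
  moreover have "?I (\<lambda>x. (f x - \<phi> x)\<^sup>2) = ?I (\<lambda>x. (f x)\<^sup>2) + N - 2 * A"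
  proof -
    have i: "integrable torus_measure (\<lambda>x. (f x)\<^sup>2)" "integrable torus_measure (\<lambda>x. (\<phi> x)\<^sup>2)"
      "integrable torus_measure (\<lambda>x. 2 * (f x * \<phi> x))"
      using f trig_in_L2[OF \<phi>] in_L2_mult_integrable[OF f trig_in_L2[OF \<phi>]] by (auto simp: in_L2_def)
    have "?I (\<lambda>x. (f x - \<phi> x)\<^sup>2) = ?I (\<lambda>x. (f x)\<^sup>2 + (\<phi> x)\<^sup>2 - 2 * (f x * \<phi> x))"
      by (simp add: power2_diff mult.assoc)
    also have "\<dots> = ?I (\<lambda>x. (f x)\<^sup>2 + (\<phi> x)\<^sup>2) - ?I (\<lambda>x. 2 * (f x * \<phi> x))"
      using i by (intro Bochner_Integration.integral_diff) auto
    also have "?I (\<lambda>x. (f x)\<^sup>2 + (\<phi> x)\<^sup>2) = ?I (\<lambda>x. (f x)\<^sup>2) + N"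
      unfolding N_def using i by (intro Bochner_Integration.integral_add)
    finally show ?thesis
      by (simp add: A_def)
  qed
  moreover have "\<beta> * K = 16 * \<eta> * K / s\<^sup>2"
    by (simp add: \<beta>_def)
  ultimately show "?I (\<lambda>x. (f x)\<^sup>2) \<le> 80 * s\<^sup>2 * ?I (\<lambda>x. (norm (g x))\<^sup>2) + 16 * \<eta> * K / s\<^sup>2 + \<epsilon>"
    using close \<open>N \<ge> 0\<close> unfolding L_def G_def[symmetric] by linarith
qed

section \<open>Choice of the concentration level and the length scale\<close>

theorem proposition3p2:
  fixes K :: real and \<F> :: "(real \<times> real \<Rightarrow> real) set"
  assumes "K > 0"
    and "\<F> \<subseteq> H1"
    and "\<forall>f\<in>\<F>. mean_free f"
    and "\<forall>f\<in>\<F>. L1_norm f \<le> K"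
    and "((\<lambda>r::real. SUP f\<in>\<F>. SUP z\<in>torus.
            \<integral>\<^sup>+y\<in>{y. torus_dist z y < r}. ennreal \<bar>f y\<bar> \<partial>torus_measure) \<longlongrightarrow> 0) (at_right 0)"
  shows "\<exists>\<Upsilon> :: real \<Rightarrow> real.
           C1_on_nonneg \<Upsilon> \<and> convex_on {0..} \<Upsilon> \<and> strict_mono_on {0..} \<Upsilon> \<and> superquadratic \<Upsilon> \<and>
           (\<forall>f\<in>\<F>. \<Upsilon> ((L2_norm f)\<^sup>2) \<le> (L2_norm (weak_gradient f))\<^sup>2)"
proof -
  define P where "P X G \<longleftrightarrow> (\<exists>f\<in>\<F>. X = (L2_norm f)\<^sup>2 \<and> G = (L2_norm (weak_gradient f))\<^sup>2)" for X G
  have "\<exists>R. \<forall>X G. P X G \<longrightarrow> R \<le> X \<longrightarrow> C * X\<^sup>2 \<le> G" for C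
  proof -
    \<comment> \<open>Raising \<open>C\<close> to at least 1 keeps \<open>\<eta>\<close> positive;
      \<open>\<eta>\<close> is the value that makes the final constant exactly
      \<open>C'\<close>.\<close>
    define C' where "C' = max C 1"
    define \<eta> where "\<eta> = 1 / (5120 * K * C')"
    have \<eta>: "0 < \<eta>" "5120 * (\<eta> * K) * C' = 1"
      using assms(1) by (auto simp: \<eta>_def C'_def max_def)
    have "\<forall>\<^sub>F r in at_right 0. (SUP f\<in>\<F>. SUP z\<in>torus.
        \<integral>\<^sup>+y\<in>{y. torus_dist z y < r}. ennreal \<bar>f y\<bar> \<partial>torus_measure) < ennreal \<eta>"
      using assms(5) by (rule order_tendstoD(2)) (use \<eta> in simp)
    then obtain b :: real where "0 < b" and b: "\<And>r. 0 < r \<Longrightarrow> r < b \<Longrightarrow> (SUP f\<in>\<F>. SUP z\<in>torus.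
        \<integral>\<^sup>+y\<in>{y. torus_dist z y < r}. ennreal \<bar>f y\<bar> \<partial>torus_measure) < ennreal \<eta>"
      unfolding eventually_at_right_field by auto
    define r where "r = b / 2"
    have "0 < r" "r < b"
      using \<open>0 < b\<close> by (auto simp: r_def)
    have conc: "(\<integral>\<^sup>+y\<in>{y. torus_dist z y < r}. ennreal \<bar>f y\<bar> \<partial>torus_measure) \<le> ennreal \<eta>"
      if "f \<in> \<F>" "z \<in> torus" for f z
    proof -
      have "(\<integral>\<^sup>+y\<in>{y. torus_dist z y < r}. ennreal \<bar>f y\<bar> \<partial>torus_measure) \<le>
          (SUP f\<in>\<F>. SUP z\<in>torus. \<integral>\<^sup>+y\<in>{y. torus_dist z y < r}. ennreal \<bar>f y\<bar> \<partial>torus_measure)"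
        using that by (intro SUP_upper2[of f] SUP_upper2[of z]) auto
      with b[OF \<open>0 < r\<close> \<open>r < b\<close>] show ?thesis
        by simp
    qed
    \<comment> \<open>Dividing by 3 secures the strict inequality \<open>2 * s0 < r\<close>;
      \<open>R\<close> is then the size of \<open>X\<close> from which the scale \<open>s\<close>
      below is at most \<open>s0\<close>.\<close>
    define s0 where "s0 = min (r / 3) (2 * pi)"
    have s0: "0 < s0" "s0 \<le> 2 * pi" "2 * s0 < r"
      using \<open>0 < r\<close> by (auto simp: s0_def min_def)
    define R where "R = 32 * \<eta> * K / s0\<^sup>2"
    have "0 < R"
      using \<eta>(1) assms(1) s0 by (simp add: R_def)
    show ?thesis
    proof (intro exI[of _ R] allI impI)
      fix X G assume "P X G" "R \<le> X"
      then obtain f where f: "f \<in> \<F>" and X: "X = (L2_norm f)\<^sup>2"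
        and G: "G = (L2_norm (weak_gradient f))\<^sup>2"
        unfolding P_def by blast
      have "in_L2 f" and "\<exists>g. in_L2 g \<and> has_weak_gradient f g"
        using f assms(2) by (auto simp: H1_def)
      then have g: "in_L2 (weak_gradient f)" "has_weak_gradient f (weak_gradient f)"
        unfolding weak_gradient_def by (metis (mono_tags, lifting) someI_ex)+
      have X_eq: "X = (\<integral>x. (f x)\<^sup>2 \<partial>torus_measure)"
        unfolding X L2_norm_def by (subst real_sqrt_pow2) (auto intro!: integral_nonneg_AE)
      have G_eq: "G = (\<integral>x. (norm (weak_gradient f x))\<^sup>2 \<partial>torus_measure)"
        unfolding G L2_norm_def by (subst real_sqrt_pow2) (auto intro!: integral_nonneg_AE)
      have "0 < X"
        using \<open>0 < R\<close> \<open>R \<le> X\<close> by simp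
      \<comment> \<open>With this scale the concentration term equals \<open>X / 2\<close> and is
        absorbed on the left. The gradient term then gives the factor
        \<open>160 * 32 = 5120\<close>.\<close>
      define s where "s = sqrt (32 * \<eta> * K / X)"
      have s2: "s\<^sup>2 = 32 * \<eta> * K / X" and "0 < s"
        using \<eta>(1) assms(1) \<open>0 < X\<close> by (auto simp: s_def)
      have "32 * \<eta> * K \<le> X * s0\<^sup>2"
        using \<open>R \<le> X\<close> s0(1) unfolding R_def by (subst (asm) pos_divide_le_eq) auto
      then have "s\<^sup>2 \<le> s0\<^sup>2"
        unfolding s2 pos_divide_le_eq[OF \<open>0 < X\<close>] mult.commute[of "s0\<^sup>2" X] .
      then have "s \<le> s0"
        using s0(1) by (auto intro: power2_le_imp_le)
      have "(\<integral>x. \<bar>f x\<bar> \<partial>torus_measure) \<le> K"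
        using assms(4) f by (auto simp: L1_norm_def)
      then have "X \<le> 80 * s\<^sup>2 * G + 16 * \<eta> * K / s\<^sup>2"
        unfolding X_eq G_eq
        using \<open>in_L2 f\<close> g \<open>0 < s\<close> \<open>s \<le> s0\<close> s0 \<eta>(1) conc[OF f]
        by (intro L2_norm_le_gradient[where r = r]) auto
      also have "16 * \<eta> * K / s\<^sup>2 = X / 2"
        using \<eta>(1) assms(1) \<open>0 < X\<close> by (simp add: s2)
      finally have "X \<le> 2 * (80 * s\<^sup>2 * G)"
        by simp
      then have "X * X \<le> X * (2 * (80 * s\<^sup>2 * G))"
        using \<open>0 < X\<close> by (intro mult_left_mono) auto
      also have "\<dots> = 160 * (X * s\<^sup>2) * G"
        by (simp only: mult_ac)
      also have "X * s\<^sup>2 = 32 * \<eta> * K"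
        using \<open>0 < X\<close> by (simp add: s2)
      finally have "X\<^sup>2 \<le> 5120 * (\<eta> * K) * G"
        by (simp add: power2_eq_square mult.assoc)
      then have "C' * X\<^sup>2 \<le> C' * (5120 * (\<eta> * K) * G)"
        by (intro mult_left_mono) (auto simp: C'_def)
      also have "\<dots> = (5120 * (\<eta> * K) * C') * G"
        by (simp only: mult_ac)
      finally have "C' * X\<^sup>2 \<le> G"
        unfolding \<eta>(2) by simp
      moreover have "C * X\<^sup>2 \<le> C' * X\<^sup>2"
        by (intro mult_right_mono) (auto simp: C'_def)
      ultimately show "C * X\<^sup>2 \<le> G"
        by linarith
    qed
  qed
  moreover have "0 \<le> X \<and> 0 \<le> G" if "P X G" for X G
    using that by (auto simp: P_def)
  ultimately obtain \<Upsilon> where "C1_on_nonneg \<Upsilon>" "convex_on {0..} \<Upsilon>" "strict_mono_on {0..} \<Upsilon>"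
    "superquadratic \<Upsilon>" "\<forall>X G. P X G \<longrightarrow> \<Upsilon> X \<le> G"
    using superquadratic_minorant[of P] by metis
  then show ?thesis
    unfolding P_def by blast
qed

end
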